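(* Let $k\ge 1$. The linear map $\phi_k:\overrightarrow{D}_k\to Ser_k$ satisfies $$\phi_k(d_1d_2)=\phi_k(d_1)\phi_k(d_2)\quad\text{for all } d_1,d_2\in\overrightarrow{D}_k .$$ Hence $\overrightarrow{D}_k$ is isomorphic to $Ser_k$ as an associative superalgebra.
   Context: The ground field is $\mathbb{C}$; superspaces and superalgebras are $\mathbb{Z}_2$-graded (superalgebras are not assumed associative a priori). **Sergeev superalgebra.** $Ser_k$ is the associative unital superalgebra generated by even $s_1,\dots,s_{k-1}$ and odd $c_1,\dots,c_k$ subject to (for admissible $i,j$): $s_i^2=1$; $s_is_{i+1}s_i=s_{i+1}s_is_{i+1}$; $s_is_j=s_js_i$ ($|i-j|>1$); $c_i^2=-1$; $c_ic_j=-c_jc_i$ ($i\ne j$); $s_ic_is_i=c_{i+1}$; $s_ic_j=c_js_i$ ($j\neq i,i+1$). The $s_i$ generate a copy of $\mathbb{C}\Sigma_k$, where $\Sigma_k$ is the symmetric group, and $Ser_k$ has basis $\{\sigma c_{i_1}\cdots c_{i_m}\mid \sigma\in\Sigma_k,\ 1\le i_1<\cdots<i_m\le k\}$. **$k$-superdiagrams.** A $k$-superdiagram consists of $k$ vertices in a top row and $k$ vertices in a bottom row (each row numbered $1,\dots,k$ from left to right) and $k$ edges, such that each top vertex is connected to exactly one bottom vertex (a bijection), each edge being either marked or not marked (normal). A $k$-superdiagram is even (resp. odd) if its number of marked edges is even (resp. odd). $\overrightarrow{D}_k$ is the superspace with basis the set of $k$-superdiagrams. **Multiplication on $\overrightarrow{D}_k$**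 (bilinear). For $k$-superdiagrams $d_1,d_2$: put $d_1$ under $d_2$ and identify the bottom vertices of $d_2$ with the top vertices of $d_1$; an edge of the resulting diagram is declared marked iff the number of marked edges of $d_1$ and $d_2$ forming it is odd. The resulting $k$-superdiagram is $d_1*d_2$. Let $\rho(d_1,d_2)$ be the number of edges of $d_1*d_2$ obtained by connecting a marked edge of $d_1$ and a marked edge of $d_2$. Let $e_1,\dots,e_p$ be the marked edges of $d_1$, ordered by their top vertices from left to right, and let $a_i$ be the (number of the) top vertex of the edge of $d_2$ connected to $e_i$; let $b_1\cdots b_q$ be the top vertices of the marked edges of $d_2$ read from left to right. Let $\ell(d_1,d_2)$ be the arranging number of the sequence $a_1\cdots a_pb_1\cdots b_q$, where the arranging number of a finite sequence of integers is the length of the permutation obtained by standardizing it (equal entries are numbered increasingly from left to right); equivalently, it is the number of pairs of positions $s<t$ such that the $s$-th entry is strictly larger than the $t$-th entry. Then $$d_1d_2=(-1)^{\rho(d_1,d_2)+\ell(d_1,d_2)}\,d_1*d_2 .$$ **The map $\phi_k$.** For a $k$-superdiagram $d$, let $\sigma\in\Sigma_k$ be the permutation such that the $i$-th top vertex is connected to the $\sigma(i)$-th bottom vertex, and let $i_1<\cdots<i_m$ be the top vertices of the marked edges. Then $\phi_k(d)=\sigma c_{i_1}\cdots c_{i_m}$, extended linearly. *)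

theory Defs
  imports
    Complex_Main
    "HOL-Algebra.Module"
    "HOL-Algebra.QuotRing"
    "HOL-Algebra.Algebraic_Closure_Type"
    "HOL-Library.Poly_Mapping"
    "HOL-Library.Z2"
    "HOL-Combinatorics.Transposition"
begin

section \<open>Complex superalgebras\<close>

abbreviation complex_field :: "complex ring"
  where "complex_field \<equiv> ring_of_type_algebra"

text \<open>The type \<^typ>\<open>bit\<close> is the field with two elements; \<open>hgs A 0\<close> and \<open>hgs A 1\<close> are the
  even and the odd part of \<open>A\<close>.\<close>

record 'a superalg = "(complex, 'a) module" +
  hgs :: "bit \<Rightarrow> 'a set"

text \<open>Associativity is not assumed, and the record component \<^const>\<open>one\<close> is unconstrained here.\<close>

locale superalgebra = module complex_field A for A :: "('a, 'm) superalg_scheme" (structure) +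
  assumes mult_closed: "\<lbrakk>x \<in> carrier A; y \<in> carrier A\<rbrakk> \<Longrightarrow> x \<otimes> y \<in> carrier A"
    and mult_add_left:
      "\<lbrakk>x \<in> carrier A; y \<in> carrier A; z \<in> carrier A\<rbrakk> \<Longrightarrow> (x \<oplus> y) \<otimes> z = x \<otimes> z \<oplus> y \<otimes> z"
    and mult_add_right:
      "\<lbrakk>x \<in> carrier A; y \<in> carrier A; z \<in> carrier A\<rbrakk> \<Longrightarrow> z \<otimes> (x \<oplus> y) = z \<otimes> x \<oplus> z \<otimes> y"
    and mult_smult_left:
      "\<lbrakk>x \<in> carrier A; y \<in> carrier A\<rbrakk> \<Longrightarrow> (c \<odot> x) \<otimes> y = c \<odot> (x \<otimes> y)"
    and mult_smult_right:
      "\<lbrakk>x \<in> carrier A; y \<in> carrier A\<rbrakk> \<Longrightarrow> x \<otimes> (c \<odot> y) = c \<odot> (x \<otimes> y)"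
    and hgs_submodule: "submodule (hgs A i) complex_field A"
    and hgs_sum: "hgs A 0 <+>\<^bsub>A\<^esub> hgs A 1 = carrier A"
    and hgs_disjoint: "hgs A 0 \<inter> hgs A 1 = {\<zero>}"
    and hgs_mult: "\<lbrakk>x \<in> hgs A i; y \<in> hgs A j\<rbrakk> \<Longrightarrow> x \<otimes> y \<in> hgs A (i + j)"

locale assoc_superalgebra = superalgebra A + monoid A
  for A :: "('a, 'm) superalg_scheme" (structure)

definition superalg_iso ::
    "('a, 'm) superalg_scheme \<Rightarrow> ('b, 'n) superalg_scheme \<Rightarrow> ('a \<Rightarrow> 'b) set"
  where "superalg_iso A B =
    {h \<in> ring_hom A B.
       (\<forall>c. \<forall>x\<in>carrier A. h (c \<odot>\<^bsub>A\<^esub> x) = c \<odot>\<^bsub>B\<^esub> h x) \<and>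
       (\<forall>i. h ` hgs A i \<subseteq> hgs B i) \<and>
       bij_betw h (carrier A) (carrier B)}"

definition assoc_superalg_isomorphic ::
    "('a, 'm) superalg_scheme \<Rightarrow> ('b, 'n) superalg_scheme \<Rightarrow> bool"
  where "assoc_superalg_isomorphic A B \<longleftrightarrow>
    assoc_superalgebra A \<and> assoc_superalgebra B \<and> (\<exists>h. h \<in> superalg_iso A B)"

text \<open>Quotient by a two-sided ideal, extending \<^const>\<open>FactRing\<close> by scalar multiplication and grading.
  It is a superalgebra when the ideal is generated by homogeneous elements.\<close>

definition FactSuperalg :: "('a, 'm) superalg_scheme \<Rightarrow> 'a set \<Rightarrow> 'a set superalg"
  where "FactSuperalg A I =
    \<lparr>carrier = carrier (A Quot I), monoid.mult = monoid.mult (A Quot I), one = \<one>\<^bsub>A Quot I\<^esub>,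
     zero = \<zero>\<^bsub>A Quot I\<^esub>, add = add (A Quot I),
     module.smult = (\<lambda>a K. \<Union>x\<in>K. I +>\<^bsub>A\<^esub> (a \<odot>\<^bsub>A\<^esub> x)),
     hgs = (\<lambda>i. (\<lambda>x. I +>\<^bsub>A\<^esub> x) ` hgs A i)\<rparr>"


section \<open>The Sergeev superalgebra\<close>

text \<open>Lists form the free monoid under concatenation, so the monoid algebra
  \<open>'a list \<Rightarrow>\<^sub>0 complex\<close> is the free associative unital algebra on \<^typ>\<open>'a\<close>.\<close>

instantiation list :: (type) monoid_add
begin

definition zero_list :: "'a list" where "zero_list = []"

definition plus_list :: "'a list \<Rightarrow> 'a list \<Rightarrow> 'a list" where "plus_list = (@)"

instance by standard (simp_all add: zero_list_def plus_list_def)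

end

datatype gen = gS nat | gC nat

definition gens :: "nat \<Rightarrow> gen set"
  where "gens k = gS ` {1..<k} \<union> gC ` {1..k}"

definition is_C :: "gen \<Rightarrow> bool"
  where "is_C g \<longleftrightarrow> (\<exists>i. g = gC i)"

definition free_superalg :: "nat \<Rightarrow> (gen list \<Rightarrow>\<^sub>0 complex) superalg"
  where "free_superalg k =
    \<lparr>carrier = {p. Poly_Mapping.keys p \<subseteq> lists (gens k)},
     monoid.mult = (*), one = 1, zero = 0, add = (+),
     module.smult = (\<lambda>c. Poly_Mapping.map ((*) c)),
     hgs = (\<lambda>i. {p. Poly_Mapping.keys p \<subseteq>
                    {w \<in> lists (gens k). of_nat (length (filter is_C w)) = i}})\<rparr>"

abbreviation fs :: "nat \<Rightarrow> gen list \<Rightarrow>\<^sub>0 complex"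
  where "fs i \<equiv> Poly_Mapping.single [gS i] 1"

abbreviation fc :: "nat \<Rightarrow> gen list \<Rightarrow>\<^sub>0 complex"
  where "fc i \<equiv> Poly_Mapping.single [gC i] 1"

text \<open>An element \<open>x - y\<close> below stands for the defining relation \<open>x = y\<close>.\<close>

definition sergeev_relators :: "nat \<Rightarrow> (gen list \<Rightarrow>\<^sub>0 complex) set"
  where "sergeev_relators k =
      {fs i * fs i - 1 | i. i \<in> {1..<k}}
    \<union> {fs i * fs (i + 1) * fs i - fs (i + 1) * fs i * fs (i + 1) | i. i \<in> {1..<k} \<and> i + 1 \<in> {1..<k}}
    \<union> {fs i * fs j - fs j * fs i | i j. i \<in> {1..<k} \<and> j \<in> {1..<k} \<and> \<bar>int i - int j\<bar> > 1}
    \<union> {fc i * fc i - (- 1) | i. i \<in> {1..k}}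
    \<union> {fc i * fc j - (- (fc j * fc i)) | i j. i \<in> {1..k} \<and> j \<in> {1..k} \<and> i \<noteq> j}
    \<union> {fs i * fc i * fs i - fc (i + 1) | i. i \<in> {1..<k}}
    \<union> {fs i * fc j - fc j * fs i | i j. i \<in> {1..<k} \<and> j \<in> {1..k} \<and> j \<noteq> i \<and> j \<noteq> i + 1}"

definition sergeev_ideal :: "nat \<Rightarrow> (gen list \<Rightarrow>\<^sub>0 complex) set"
  where "sergeev_ideal k = Idl\<^bsub>free_superalg k\<^esub> (sergeev_relators k)"

definition Ser :: "nat \<Rightarrow> (gen list \<Rightarrow>\<^sub>0 complex) set superalg"
  where "Ser k = FactSuperalg (free_superalg k) (sergeev_ideal k)"

definition ser_monomial :: "nat \<Rightarrow> gen list \<Rightarrow> (gen list \<Rightarrow>\<^sub>0 complex) set"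
  where "ser_monomial k w = sergeev_ideal k +>\<^bsub>free_superalg k\<^esub> Poly_Mapping.single w 1"

text \<open>Permutations are multiplied as functions, from right to left.\<close>

definition transposition_prod :: "nat list \<Rightarrow> nat \<Rightarrow> nat"
  where "transposition_prod js = foldr (\<lambda>j \<sigma>. transpose j (j + 1) \<circ> \<sigma>) js id"

text \<open>The image in \<open>Ser k\<close> of a permutation \<open>\<sigma>\<close> of \<open>{1..k}\<close>: the common value of the products
  \<open>s\<^sub>j\<^sub>1 \<cdots> s\<^sub>j\<^sub>r\<close> over all expressions of \<open>\<sigma>\<close> as a product of the simple
  transpositions \<open>(j\<^sub>1 j\<^sub>1+1), \<dots>, (j\<^sub>r j\<^sub>r+1)\<close>.\<close>

definition ser_perm :: "nat \<Rightarrow> (nat \<Rightarrow> nat) \<Rightarrow> (gen list \<Rightarrow>\<^sub>0 complex) set"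
  where "ser_perm k \<sigma> =
    (THE x. \<exists>js. set js \<subseteq> {1..<k} \<and> transposition_prod js = \<sigma> \<and> x = ser_monomial k (map gS js))"


section \<open>The superalgebra of superdiagrams\<close>

text \<open>An edge is a pair (top vertex, bottom vertex).\<close>

record superdiagram =
  edges :: "(nat \<times> nat) set"
  marked :: "(nat \<times> nat) set"

definition superdiagrams :: "nat \<Rightarrow> superdiagram set"
  where "superdiagrams k =
    {d. edges d \<subseteq> {1..k} \<times> {1..k} \<and>
        (\<forall>i\<in>{1..k}. \<exists>!j. (i, j) \<in> edges d) \<and>
        (\<forall>j\<in>{1..k}. \<exists>!i. (i, j) \<in> edges d) \<and>
        marked d \<subseteq> edges d}"

text \<open>In the functions below \<open>d1\<close> is placed under \<open>d2\<close>.\<close>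

definition dstar :: "superdiagram \<Rightarrow> superdiagram \<Rightarrow> superdiagram"
  where "dstar d1 d2 =
    \<lparr>edges = {(x, z). \<exists>y. (x, y) \<in> edges d2 \<and> (y, z) \<in> edges d1},
     marked = {(x, z). \<exists>y. (x, y) \<in> edges d2 \<and> (y, z) \<in> edges d1 \<and>
                 odd (of_bool ((x, y) \<in> marked d2) + of_bool ((y, z) \<in> marked d1) :: nat)}\<rparr>"

definition rho :: "superdiagram \<Rightarrow> superdiagram \<Rightarrow> nat"
  where "rho d1 d2 = card {(x, z). \<exists>y. (x, y) \<in> marked d2 \<and> (y, z) \<in> marked d1}"

definition marked_tops :: "superdiagram \<Rightarrow> nat list"
  where "marked_tops d = sorted_list_of_set (fst ` marked d)"

definition arranging_number :: "nat list \<Rightarrow> nat"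
  where "arranging_number xs = card {(u, v). u < v \<and> v < length xs \<and> xs ! u > xs ! v}"

definition ell :: "superdiagram \<Rightarrow> superdiagram \<Rightarrow> nat"
  where "ell d1 d2 =
    arranging_number (map (\<lambda>y. THE x. (x, y) \<in> edges d2) (marked_tops d1) @ marked_tops d2)"

text \<open>The record component \<^const>\<open>one\<close> is filled by the identity diagram without marked edges; that it is a
  unit has to be proved.\<close>

definition Dvec :: "nat \<Rightarrow> (superdiagram \<Rightarrow>\<^sub>0 complex) superalg"
  where "Dvec k =
    \<lparr>carrier = {p. Poly_Mapping.keys p \<subseteq> superdiagrams k},
     monoid.mult = (\<lambda>p q. \<Sum>d1\<in>Poly_Mapping.keys p. \<Sum>d2\<in>Poly_Mapping.keys q.
              Poly_Mapping.single (dstar d1 d2)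
                (Poly_Mapping.lookup p d1 * Poly_Mapping.lookup q d2 *
                 (- 1) ^ (rho d1 d2 + ell d1 d2))),
     one = Poly_Mapping.single \<lparr>edges = Id_on {1..k}, marked = {}\<rparr> 1,
     zero = 0, add = (+),
     module.smult = (\<lambda>a. Poly_Mapping.map ((*) a)),
     hgs = (\<lambda>i. {p. Poly_Mapping.keys p \<subseteq>
                    {d \<in> superdiagrams k. of_nat (card (marked d)) = i}})\<rparr>"


section \<open>The map from superdiagrams to the Sergeev superalgebra\<close>

definition diagram_perm :: "nat \<Rightarrow> superdiagram \<Rightarrow> nat \<Rightarrow> nat"
  where "diagram_perm k d = (\<lambda>i. if i \<in> {1..k} then THE j. (i, j) \<in> edges d else i)"

definition phi_basis :: "nat \<Rightarrow> superdiagram \<Rightarrow> (gen list \<Rightarrow>\<^sub>0 complex) set"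
  where "phi_basis k d =
    ser_perm k (diagram_perm k d) \<otimes>\<^bsub>Ser k\<^esub> ser_monomial k (map gC (marked_tops d))"

definition phi :: "nat \<Rightarrow> (superdiagram \<Rightarrow>\<^sub>0 complex) \<Rightarrow> (gen list \<Rightarrow>\<^sub>0 complex) set"
  where "phi k p =
    (\<Oplus>\<^bsub>Ser k\<^esub>d\<in>Poly_Mapping.keys p. Poly_Mapping.lookup p d \<odot>\<^bsub>Ser k\<^esub> phi_basis k d)"

end

theory Submission
  imports Defs "HOL-Combinatorics.Permutations"
begin

text \<open>
  By the Coxeter presentation of the symmetric group, and because \<open>c\<^sub>j \<sigma> = \<sigma> c\<^sub>i\<close> for
  \<open>i = \<sigma>\<^sup>-\<^sup>1(j)\<close>, a product \<open>\<sigma> c\<^sub>I \<tau> c\<^sub>J\<close> in the Sergeev superalgebra equals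
  \<open>\<sigma>\<tau>\<close> times the Clifford word \<open>a\<^sub>1 \<dots> a\<^sub>p b\<^sub>1 \<dots> b\<^sub>q\<close> of the definition of \<open>\<ell>\<close>. Sorting that
  word costs \<open>-1\<close> for each inversion and for each pair of equal letters, which is the sign in the
  product of diagrams. Injectivity comes from letting the free algebra act on functions of pairs
  (permutation, subset) as on the regular representation: the relators act as zero, while the words
  attached to distinct diagrams are separated by evaluation at \<open>(id, {})\<close>. Associativity and the unit
  of the diagram algebra are then pulled back along the injection, and the grading of the Sergeev
  superalgebra is direct because it is the image of the grading by marked edges.
\<close>

unbundle no m_inv_syntax

section \<open>The Coxeter presentation of the symmetric group\<close>

text \<open>The element \<open>ser_perm k \<sigma>\<close> is a definite description, so the Coxeter
  presentation is used in its hard direction: any two words in the \<open>gS\<close> with the same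
  permutation must have the same class, for otherwise the description has no known value.
  Completeness is proved by a normal form along the chain of symmetric groups on 1, 2, ..., k
  points, which is why the relation bounds its letters by \<open>k\<close>. In the other direction,
  relations can only identify words, so no calculation with them shows that a combination of classes
  is nonzero. The model that decides this has to be built without reference to \<open>Ser\<close>.
  Injectivity and surjectivity of \<open>phi\<close> together amount to the basis theorem for the
  Sergeev superalgebra. The superalgebra axioms of \<open>Ser\<close> come late for the same reason:
  most are checked on representatives, but that the even and odd parts meet only in zero depends on
  the size of the ideal, and is obtained from the injectivity of \<open>phi\<close>.\<close>

inductive cox :: "nat \<Rightarrow> nat list \<Rightarrow> nat list \<Rightarrow> bool" for k :: nat
  where
    square: "\<lbrakk>set (a @ i # b) \<subseteq> {1..<k}\<rbrakk> \<Longrightarrow> cox k (a @ [i, i] @ b) (a @ b)"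
  | braid: "\<lbrakk>set (a @ [i, Suc i] @ b) \<subseteq> {1..<k}\<rbrakk>
      \<Longrightarrow> cox k (a @ [i, Suc i, i] @ b) (a @ [Suc i, i, Suc i] @ b)"
  | commute: "\<lbrakk>set (a @ [i, j] @ b) \<subseteq> {1..<k}; Suc i < j\<rbrakk>
      \<Longrightarrow> cox k (a @ [i, j] @ b) (a @ [j, i] @ b)"
  | equiv_refl: "set w \<subseteq> {1..<k} \<Longrightarrow> cox k w w"
  | equiv_sym: "cox k u v \<Longrightarrow> cox k v u"
  | equiv_trans: "\<lbrakk>cox k u v; cox k v w\<rbrakk> \<Longrightarrow> cox k u w"

declare cox.equiv_trans [trans]

text \<open>The three rewriting rules already carry a context, so an enlarged context gives another
  instance of the same rule.\<close>

lemma cox_context: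
  assumes "cox k u v" "set a \<subseteq> {1..<k}" "set b \<subseteq> {1..<k}"
  shows "cox k (a @ u @ b) (a @ v @ b)"
  using assms
proof (induction rule: cox.induct)
  case (square a' i b')
  then show ?case using cox.square[of "a @ a'" i "b' @ b" k] by simp
next
  case (braid a' i b')
  then show ?case using cox.braid[of "a @ a'" i "b' @ b" k] by simp
next
  case (commute a' i j b')
  then show ?case using cox.commute[of "a @ a'" i j "b' @ b" k] by simp
next
  case (equiv_refl w)
  then show ?case by (intro cox.equiv_refl) auto
qed (auto intro: cox.equiv_sym cox.equiv_trans)

lemma cox_append:
  assumes "cox k u u'" "cox k v v'" "set u' \<subseteq> {1..<k}" "set v \<subseteq> {1..<k}"
  shows "cox k (u @ v) (u' @ v')"
proof -
  have "cox k (u @ v) (u' @ v)" using cox_context[of k u u' "[]" v] assms by simp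
  also have "cox k (u' @ v) (u' @ v')" using cox_context[of k v v' u' "[]"] assms by simp
  finally show ?thesis .
qed

lemma cox_mono: "\<lbrakk>cox k u v; k \<le> k'\<rbrakk> \<Longrightarrow> cox k' u v"
proof (induction rule: cox.induct)
  case (square a i b) then show ?case by (intro cox.square) fastforce
next
  case (braid a i b) then show ?case by (intro cox.braid) fastforce
next
  case (commute a i j b) then show ?case by (intro cox.commute) fastforce+
next
  case (equiv_refl w) then show ?case by (intro cox.equiv_refl) fastforce
qed (auto intro: cox.equiv_sym cox.equiv_trans)

lemma cox_commute':
  assumes "set [i, j] \<subseteq> {1..<k}" "Suc i < j \<or> Suc j < i"
  shows "cox k [i, j] [j, i]"
  using assms cox.commute[of "[]" i j "[]" k] cox.commute[of "[]" j i "[]" k] cox.equiv_sym by auto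

lemma cox_commute_list:
  assumes "set w \<subseteq> {1..<k}" "i \<in> {1..<k}" "\<And>j. j \<in> set w \<Longrightarrow> Suc i < j \<or> Suc j < i"
  shows "cox k (w @ [i]) (i # w)"
  using assms
proof (induction w)
  case Nil
  then show ?case by (auto intro: cox.equiv_refl)
next
  case (Cons j w)
  have "cox k ([j] @ (w @ [i])) ([j] @ (i # w))"
    using Cons by (intro cox_append Cons.IH cox.equiv_refl) auto
  also have "[j] @ (i # w) = [j, i] @ w" by simp
  also have "cox k \<dots> ([i, j] @ w)"
    using Cons.prems cox_commute'[of j i k] by (intro cox_append cox.equiv_refl) auto
  finally show ?case by simp
qed

text \<open>The word k, k-1, ..., j. For j at most k its permutation is a cycle taking j to
  \<open>Suc k\<close>; j = \<open>Suc k\<close> gives the empty word and so the trivial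
  coset.\<close>

definition desc :: "nat \<Rightarrow> nat \<Rightarrow> nat list"
  where "desc k j = rev [j..<Suc k]"

lemma set_desc [simp]: "set (desc k j) = {j..k}"
  by (auto simp: desc_def)

lemma desc_snoc: "j \<le> k \<Longrightarrow> desc k j = desc k (Suc j) @ [j]"
  by (simp add: desc_def upt_rec del: upt_Suc)

lemma desc_append: "\<lbrakk>j \<le> Suc m; m \<le> k\<rbrakk> \<Longrightarrow> desc k j = desc k (Suc m) @ desc m j"
  using upt_add_eq_append[of j "Suc m" "k - m"] by (simp add: desc_def del: upt_Suc)

text \<open>Exposes the adjacent letters \<open>Suc (Suc m)\<close> and \<open>Suc m\<close>, on
  which a second \<open>Suc (Suc m)\<close> arriving from the right can act by a braid
  relation.\<close>

lemma desc_split: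
  assumes "j \<le> Suc m" "Suc (Suc m) \<le> k"
  shows "desc k j = desc k (Suc (Suc (Suc m))) @ [Suc (Suc m), Suc m] @ desc m j"
proof -
  have "desc k j = desc k (Suc m) @ desc m j"
    using assms by (intro desc_append) auto
  also have "desc k (Suc m) = desc k (Suc (Suc (Suc m))) @ [Suc (Suc m), Suc m]"
    using assms by (simp add: desc_snoc)
  finally show ?thesis by simp
qed

lemma desc_empty [simp]: "k < j \<Longrightarrow> desc k j = []"
  by (simp add: desc_def)

text \<open>Right multiplication by a generator permutes the cosets of the smaller symmetric group.
  Depending on its position relative to \<open>j\<close>, the letter \<open>i\<close> commutes
  through the whole word, extends it, cancels its last letter, or passes through by a braid and
  emerges on the left as \<open>i - 1\<close>.\<close>

lemma cox_desc_step:
  assumes "j \<in> {1..Suc k}" "i \<in> {1..k}"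
  obtains js j' where "set js \<subseteq> {1..<k}" "j' \<in> {1..Suc k}"
    "cox (Suc k) (desc k j @ [i]) (js @ desc k j')"
proof -
  consider "Suc i < j" | "j = Suc i" | "j = i" | "j < i" by linarith
  then show thesis
  proof cases
    case 1
    then have "cox (Suc k) (desc k j @ [i]) ([i] @ desc k j)"
      using assms 1 cox_commute_list[of "desc k j" "Suc k" i] by (simp add: subset_iff)
    then show thesis using assms 1 by (intro that[of "[i]" j]) auto
  next
    case 2
    then have "cox (Suc k) (desc k j @ [i]) ([] @ desc k i)"
      using assms by (auto simp: desc_snoc intro!: cox.equiv_refl)
    then show thesis using assms by (intro that[of "[]" i]) auto
  next
    case 3
    then have "cox (Suc k) (desc k j @ [i]) ([] @ desc k (Suc j))"
      using assms 3 cox.square[of "desc k (Suc j)" j "[]" "Suc k"]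
      by (simp add: desc_snoc subset_iff)
    then show thesis using assms 3 by (intro that[of "[]" "Suc j"]) auto
  next
    case 4
    \<comment> \<open>Since \<open>j < i\<close>, the word contains both \<open>i\<close> and
      \<open>i - 1\<close>, which are named \<open>m + 2\<close> and \<open>m + 1\<close>.\<close>
    then obtain m where m: "i = Suc (Suc m)" "j \<le> Suc m"
      using assms by (cases i; cases "i - 1") auto
    let ?u = "desc k (Suc (Suc (Suc m)))" and ?v = "desc m j"
    have *: "set ?u \<subseteq> {1..<Suc k}" "set ?v \<subseteq> {1..<Suc k}" "set [Suc m, i] \<subseteq> {1..<Suc k}"
      using assms m by auto
    have "desc k j @ [i] = (?u @ [i, Suc m]) @ (?v @ [i])"
      using assms m by (subst desc_split) auto
    \<comment> \<open>The letters of \<open>?v\<close> are at most \<open>m\<close>, hence at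
      distance at least two from \<open>i\<close>.\<close>
    also have "cox (Suc k) \<dots> ((?u @ [i, Suc m]) @ (i # ?v))"
      using * m by (intro cox_append cox.equiv_refl cox_commute_list) auto
    also have "(?u @ [i, Suc m]) @ (i # ?v) = ?u @ [i, Suc m, i] @ ?v" by simp
    also have "cox (Suc k) \<dots> (?u @ [Suc m, i, Suc m] @ ?v)"
      using * cox.equiv_sym[OF cox.braid[of ?u "Suc m" ?v "Suc k"]] unfolding m(1) by simp
    also have "\<dots> = (?u @ [Suc m]) @ ([i, Suc m] @ ?v)" by simp
    \<comment> \<open>The letters of \<open>?u\<close> are at least \<open>m + 3\<close>, so
      \<open>Suc m\<close> can leave to the left.\<close>
    also have "cox (Suc k) \<dots> ((Suc m # ?u) @ ([i, Suc m] @ ?v))"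
      using * m by (intro cox_append cox.equiv_refl cox_commute_list) auto
    also have "\<dots> = [Suc m] @ desc k j"
      using assms m by (subst desc_split[of j m]) auto
    finally show thesis using assms m by (intro that[of "[Suc m]" j]) auto
  qed
qed

text \<open>The words \<open>desc k j\<close> represent the cosets of the symmetric group on \<open>k\<close> points in the one on \<open>Suc k\<close>.\<close>

lemma cox_normal_form:
  assumes "set w \<subseteq> {1..<Suc k}"
  obtains js j where "set js \<subseteq> {1..<k}" "j \<in> {1..Suc k}" "cox (Suc k) w (js @ desc k j)"
  using assms
proof (induction w arbitrary: thesis rule: rev_induct)
  case Nil
  show ?case by (rule Nil(1)[of "[]" "Suc k"]) (auto intro: cox.equiv_refl)
next
  case (snoc i w)
  obtain js j where 1: "set js \<subseteq> {1..<k}" "j \<in> {1..Suc k}" "cox (Suc k) w (js @ desc k j)"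
    using snoc by auto
  obtain js' j' where 2: "set js' \<subseteq> {1..<k}" "j' \<in> {1..Suc k}"
    "cox (Suc k) (desc k j @ [i]) (js' @ desc k j')"
    using cox_desc_step[of j k i] 1(2) snoc.prems by auto
  have "cox (Suc k) (w @ [i]) ((js @ desc k j) @ [i])"
    using 1 snoc.prems by (intro cox_append[OF 1(3)] cox.equiv_refl) auto
  also have "(js @ desc k j) @ [i] = js @ (desc k j @ [i])" by simp
  also have "cox (Suc k) \<dots> (js @ (js' @ desc k j'))"
    using 1 2 snoc.prems by (intro cox_append[OF _ 2(3)] cox.equiv_refl) auto
  also have "\<dots> = (js @ js') @ desc k j'" by simp
  finally show ?case using 1 2 by (intro snoc.prems(1)[of "js @ js'" j']) auto
qed

section \<open>Permutations of Coxeter words and completeness of the relations\<close>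

lemma transposition_prod_Nil [simp]: "transposition_prod [] = id"
  by (simp add: transposition_prod_def)

lemma transposition_prod_Cons [simp]:
  "transposition_prod (j # js) = transpose j (Suc j) \<circ> transposition_prod js"
  by (simp add: transposition_prod_def)

lemma transposition_prod_append [simp]:
  "transposition_prod (u @ v) = transposition_prod u \<circ> transposition_prod v"
  by (induction u) (auto simp: o_assoc)

lemma bij_transposition_prod: "bij (transposition_prod js)"
  by (induction js) (auto simp: id_def[symmetric] simp del: o_apply intro!: bij_comp)

lemma transposition_prod_permutes:
  "set js \<subseteq> {1..<k} \<Longrightarrow> transposition_prod js permutes {1..k}"
  by (induction js) (auto intro!: permutes_id permutes_compose permutes_swap_id)

lemma transposition_prod_cox: "cox k u v \<Longrightarrow> transposition_prod u = transposition_prod v"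
proof (induction rule: cox.induct)
  case (commute a i j b)
  then have "transpose i (Suc i) (transpose j (Suc j) x) = transpose j (Suc j) (transpose i (Suc i) x)"
    for x by (auto simp: transpose_def)
  then show ?case by (simp add: fun_eq_iff)
next
  case (braid a i b)
  have "transpose i (Suc i) (transpose (Suc i) (Suc (Suc i)) (transpose i (Suc i) x))
      = transpose (Suc i) (Suc (Suc i)) (transpose i (Suc i) (transpose (Suc i) (Suc (Suc i)) x))" for x
    by (auto simp: transpose_def)
  then show ?case by (simp add: fun_eq_iff)
qed (auto simp: fun_eq_iff)

lemma transposition_prod_desc: "j \<le> Suc k \<Longrightarrow> transposition_prod (desc k j) j = Suc k"
proof (induction "Suc k - j" arbitrary: j)
  case (Suc n)
  then show ?case by (simp add: desc_snoc)
qed (simp add: not_le)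

text \<open>In a normal form \<open>js @ desc k j\<close> the prefix fixes \<open>Suc k\<close>, so
  \<open>j\<close> is recovered as the preimage of \<open>Suc k\<close>. Equal permutations thus
  have equal coset representatives; these cancel, leaving prefixes over fewer letters for the
  induction.\<close>

theorem cox_complete:
  assumes "set u \<subseteq> {1..<k}" "set v \<subseteq> {1..<k}" "transposition_prod u = transposition_prod v"
  shows "cox k u v"
  using assms
proof (induction k arbitrary: u v)
  case 0
  then show ?case by (auto intro: cox.equiv_refl)
next
  case (Suc k)
  obtain js j where 1: "set js \<subseteq> {1..<k}" "j \<in> {1..Suc k}" "cox (Suc k) u (js @ desc k j)"
    using cox_normal_form Suc.prems(1) by blast
  obtain js' j' where 2: "set js' \<subseteq> {1..<k}" "j' \<in> {1..Suc k}" "cox (Suc k) v (js' @ desc k j')"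
    using cox_normal_form Suc.prems(2) by blast
  have top: "transposition_prod (ks @ desc k l) l = Suc k"
    if "set ks \<subseteq> {1..<k}" "l \<in> {1..Suc k}" for ks l
    using that transposition_prod_desc[of l k] permutes_not_in[OF transposition_prod_permutes, of ks k]
    by auto
  have eq: "transposition_prod (js @ desc k j) = transposition_prod (js' @ desc k j')"
    using transposition_prod_cox[OF 1(3)] transposition_prod_cox[OF 2(3)] Suc.prems(3) by metis
  have "j = j'"
    using eq top[of js j] top[of js' j'] 1 2 bij_transposition_prod[of "js @ desc k j"]
    by (metis bij_pointE)
  have "transposition_prod js = transposition_prod js'"
    using eq bij_transposition_prod[of "desc k j"] \<open>j = j'\<close>
    by (simp add: bij_is_surj fun_eq_iff) (metis bij_pointE)
  then have "cox k js js'" using Suc.IH 1 2 by blast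
  then have "cox (Suc k) (js @ desc k j) (js' @ desc k j')"
    using 1 2 cox_mono[of k js js' "Suc k"] by (auto simp: \<open>j = j'\<close> intro!: cox_append cox.equiv_refl)
  then show ?case using 1(3) 2(3) by (metis cox.equiv_sym cox.equiv_trans)
qed

lemma permutes_transposition_prod:
  assumes "\<sigma> permutes {1..k}"
  obtains js where "set js \<subseteq> {1..<k}" "transposition_prod js = \<sigma>"
  using assms
proof (induction k arbitrary: \<sigma> thesis)
  case 0
  then show ?case by (intro 0(1)[of "[]"]) auto
next
  case (Suc k)
  \<comment> \<open>The point sent to \<open>Suc k\<close> selects the coset representative;
    removing that factor leaves a permutation fixing \<open>Suc k\<close>.\<close>
  define j where "j = inv \<sigma> (Suc k)"
  have j: "\<sigma> j = Suc k" "j \<in> {1..Suc k}"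
    using Suc.prems(2) permutes_inv[OF Suc.prems(2)] permutes_in_image[of "inv \<sigma>" "{1..Suc k}" "Suc k"]
    by (auto simp: j_def permutes_inverses)
  let ?c = "transposition_prod (desc k j)"
  have c: "?c permutes {1..Suc k}" using j by (intro transposition_prod_permutes) auto
  have cj: "inv ?c (Suc k) = j"
    using transposition_prod_desc[of j k] j c by (metis atLeastAtMost_iff permutes_inverses(2))
  have "\<sigma> \<circ> inv ?c permutes {1..k}"
  proof (rule permutes_superset[of _ "{1..Suc k}"])
    show "\<sigma> \<circ> inv ?c permutes {1..Suc k}"
      using c Suc.prems(2) by (intro permutes_compose permutes_inv)
    show "(\<sigma> \<circ> inv ?c) i = i" if "i \<in> {1..Suc k} - {1..k}" for i
    proof -
      have "i = Suc k" using that by auto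
      then show ?thesis using cj j by simp
    qed
  qed
  then obtain js where js: "set js \<subseteq> {1..<k}" "transposition_prod js = \<sigma> \<circ> inv ?c"
    using Suc.IH by blast
  have "transposition_prod (js @ desc k j) = \<sigma>"
    using js c by (simp add: fun_eq_iff permutes_inverses)
  then show ?case using js j by (intro Suc.prems(1)[of "js @ desc k j"]) auto
qed

section \<open>The Sergeev superalgebra as a quotient\<close>

abbreviation smul :: "complex \<Rightarrow> ('a \<Rightarrow>\<^sub>0 complex) \<Rightarrow> 'a \<Rightarrow>\<^sub>0 complex"
  where "smul c \<equiv> Poly_Mapping.map ((*) c)"

lemma lookup_smul [simp]: "Poly_Mapping.lookup (smul c p) x = c * Poly_Mapping.lookup p x"
  by (simp add: Poly_Mapping.map.rep_eq when_def)

lemma keys_smul: "Poly_Mapping.keys (smul c p) \<subseteq> Poly_Mapping.keys p"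
  by (auto simp: in_keys_iff)

text \<open>Scalars are multiples of the empty word. This is why ring ideals are stable under
  scalars and scalar multiplication descends to the quotient.\<close>

lemma smul_eq_mult: "smul c p = Poly_Mapping.single [] c * p"
  by (metis mult_map_scale_conv_mult zero_list_def)

lemma smul_sum: "smul c (sum f A) = (\<Sum>x\<in>A. smul c (f x))"
  by (rule poly_mapping_eqI) (simp add: lookup_sum sum_distrib_left)

lemma poly_mapping_sum_single:
  assumes "finite A" "Poly_Mapping.keys p \<subseteq> A"
  shows "(\<Sum>x\<in>A. Poly_Mapping.single x (Poly_Mapping.lookup p x)) = p"
proof (rule poly_mapping_eqI)
  fix y
  show "Poly_Mapping.lookup (\<Sum>x\<in>A. Poly_Mapping.single x (Poly_Mapping.lookup p x)) y
      = Poly_Mapping.lookup p y"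
    using assms by (cases "y \<in> A") (auto simp: lookup_sum lookup_single when_def in_keys_iff)
qed

lemma keys_sum_subset:
  assumes "\<And>x. x \<in> A \<Longrightarrow> Poly_Mapping.keys (f x) \<subseteq> B"
  shows "Poly_Mapping.keys (sum f A) \<subseteq> B"
  using assms keys_sum[of f A] by fastforce

lemma keys_times_lists:
  fixes p q :: "'a list \<Rightarrow>\<^sub>0 complex"
  assumes "Poly_Mapping.keys p \<subseteq> A" "Poly_Mapping.keys q \<subseteq> B"
    and "\<And>u v. \<lbrakk>u \<in> A; v \<in> B\<rbrakk> \<Longrightarrow> u @ v \<in> C"
  shows "Poly_Mapping.keys (p * q) \<subseteq> C"
  using keys_mult[of p q] assms by (fastforce simp: plus_list_def)

lemma keys_plus_subset:
  assumes "Poly_Mapping.keys p \<subseteq> A" "Poly_Mapping.keys q \<subseteq> A"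
  shows "Poly_Mapping.keys (p + q) \<subseteq> A"
  using keys_add[of p q] assms by auto

lemma keys_uminus [simp]:
  "Poly_Mapping.keys (- p) = Poly_Mapping.keys (p :: 'a \<Rightarrow>\<^sub>0 'b::ab_group_add)"
  by (auto simp: in_keys_iff)

lemma keys_minus_subset:
  assumes "Poly_Mapping.keys p \<subseteq> A" "Poly_Mapping.keys q \<subseteq> A"
  shows "Poly_Mapping.keys (p - q :: 'a \<Rightarrow>\<^sub>0 complex) \<subseteq> A"
  using assms by (auto simp: in_keys_iff subset_iff lookup_minus) metis

lemma single_append:
  "Poly_Mapping.single (u @ v) (a * b) = Poly_Mapping.single u a * Poly_Mapping.single v (b :: complex)"
  by (simp add: mult_single plus_list_def)

lemma one_eq_single: "(1 :: 'a list \<Rightarrow>\<^sub>0 complex) = Poly_Mapping.single [] 1"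
  by (simp flip: single_one add: zero_list_def)

lemma free_simps [simp]:
  "monoid.mult (free_superalg k) = (*)" "one (free_superalg k) = 1"
  "zero (free_superalg k) = 0" "add (free_superalg k) = (+)"
  "module.smult (free_superalg k) = smul"
  by (simp_all add: free_superalg_def)

lemma carrier_free: "p \<in> carrier (free_superalg k) \<longleftrightarrow> Poly_Mapping.keys p \<subseteq> lists (gens k)"
  by (simp add: free_superalg_def)

lemma hgs_free: "p \<in> hgs (free_superalg k) i \<longleftrightarrow>
    Poly_Mapping.keys p \<subseteq> {w \<in> lists (gens k). of_nat (length (filter is_C w)) = i}"
  by (simp add: free_superalg_def)

lemma carrier_free_closed [simp, intro]:
  "0 \<in> carrier (free_superalg k)" "1 \<in> carrier (free_superalg k)"
  "set w \<subseteq> gens k \<Longrightarrow> Poly_Mapping.single w c \<in> carrier (free_superalg k)"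
  "p \<in> carrier (free_superalg k) \<Longrightarrow> - p \<in> carrier (free_superalg k)"
  "p \<in> carrier (free_superalg k) \<Longrightarrow> smul c p \<in> carrier (free_superalg k)"
  "\<lbrakk>p \<in> carrier (free_superalg k); q \<in> carrier (free_superalg k)\<rbrakk> \<Longrightarrow> p + q \<in> carrier (free_superalg k)"
  "\<lbrakk>p \<in> carrier (free_superalg k); q \<in> carrier (free_superalg k)\<rbrakk> \<Longrightarrow> p - q \<in> carrier (free_superalg k)"
  "\<lbrakk>p \<in> carrier (free_superalg k); q \<in> carrier (free_superalg k)\<rbrakk> \<Longrightarrow> p * q \<in> carrier (free_superalg k)"
  "(\<And>x. x \<in> A \<Longrightarrow> f x \<in> carrier (free_superalg k)) \<Longrightarrow> sum f A \<in> carrier (free_superalg k)"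
  unfolding carrier_free one_eq_single
  by (simp_all add: keys_plus_subset keys_minus_subset keys_sum_subset order.trans[OF keys_smul]
      lists_eq_set) (erule (1) keys_times_lists, simp)

lemma ring_free: "ring (free_superalg k)"
  by (intro ringI abelian_groupI monoidI) (auto simp: algebra_simps intro!: exI[of _ "- _"] bexI[of _ "- _"])

lemma a_inv_free: "p \<in> carrier (free_superalg k) \<Longrightarrow> a_inv (free_superalg k) p = - p"
  using abelian_group.minus_equality[OF ring.is_abelian_group[OF ring_free], of k "- p" p] by simp

lemma a_minus_free:
  "\<lbrakk>p \<in> carrier (free_superalg k); q \<in> carrier (free_superalg k)\<rbrakk>
    \<Longrightarrow> a_minus (free_superalg k) p q = p - q"
  by (simp add: a_minus_def a_inv_free)

lemma gens_iff [simp]: "gS i \<in> gens k \<longleftrightarrow> i \<in> {1..<k}" "gC i \<in> gens k \<longleftrightarrow> i \<in> {1..k}"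
  by (auto simp: gens_def)

lemma sergeev_relators_subset: "sergeev_relators k \<subseteq> carrier (free_superalg k)"
  unfolding sergeev_relators_def by auto

lemma ideal_sergeev: "ideal (sergeev_ideal k) (free_superalg k)"
  unfolding sergeev_ideal_def by (rule ring.genideal_ideal[OF ring_free sergeev_relators_subset])

section \<open>Cosets of the Sergeev ideal and the operations of the quotient\<close>

definition cls :: "nat \<Rightarrow> (gen list \<Rightarrow>\<^sub>0 complex) \<Rightarrow> (gen list \<Rightarrow>\<^sub>0 complex) set"
  where "cls k p = sergeev_ideal k +>\<^bsub>free_superalg k\<^esub> p"

lemma cls_eq_iff:
  assumes "p \<in> carrier (free_superalg k)" "q \<in> carrier (free_superalg k)"
  shows "cls k p = cls k q \<longleftrightarrow> p - q \<in> sergeev_ideal k"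
  using ring.quotient_eq_iff_same_a_r_cos[OF ring_free ideal_sergeev assms] assms
  by (simp add: cls_def a_minus_free)

lemma mem_cls: "q \<in> cls k p \<longleftrightarrow> q - p \<in> sergeev_ideal k"
  by (force simp: cls_def a_r_coset_def')

lemma sergeev_ideal_carrier: "p \<in> sergeev_ideal k \<Longrightarrow> p \<in> carrier (free_superalg k)"
  by (rule ideal.Icarr[OF ideal_sergeev])

lemma sergeev_ideal_0: "0 \<in> sergeev_ideal k"
  using additive_subgroup.zero_closed[OF ideal.axioms(1)[OF ideal_sergeev[of k]]] by simp

lemma mem_clsD:
  assumes "p \<in> carrier (free_superalg k)" "q \<in> cls k p"
  shows "q \<in> carrier (free_superalg k)" "cls k q = cls k p"
proof -
  have "p + (q - p) \<in> carrier (free_superalg k)"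
    using assms sergeev_ideal_carrier[of "q - p" k] by (intro carrier_free_closed(6)) (auto simp: mem_cls)
  then show "q \<in> carrier (free_superalg k)" by simp
  then show "cls k q = cls k p" using assms by (simp add: cls_eq_iff mem_cls)
qed

lemma cls_relator:
  "\<lbrakk>p - q \<in> sergeev_relators k; p \<in> carrier (free_superalg k); q \<in> carrier (free_superalg k)\<rbrakk>
    \<Longrightarrow> cls k p = cls k q"
  using ring.genideal_self[OF ring_free sergeev_relators_subset[of k]]
  by (auto simp: cls_eq_iff sergeev_ideal_def)

lemma cls_smul_cong:
  assumes "p \<in> carrier (free_superalg k)" "q \<in> carrier (free_superalg k)" "cls k p = cls k q"
  shows "cls k (smul c p) = cls k (smul c q)"
proof -
  have "Poly_Mapping.single [] c * (p - q) \<in> sergeev_ideal k"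
    using ideal.I_l_closed[OF ideal_sergeev, of "p - q" k "Poly_Mapping.single [] c"] assms
    by (auto simp: cls_eq_iff)
  then have "smul c p - smul c q \<in> sergeev_ideal k"
    by (simp add: smul_eq_mult right_diff_distrib)
  then show ?thesis using assms by (simp add: cls_eq_iff)
qed

lemma Ser_simps:
  "carrier (Ser k) = cls k ` carrier (free_superalg k)"
  "one (Ser k) = cls k 1"
  "zero (Ser k) = cls k 0"
  "hgs (Ser k) i = cls k ` hgs (free_superalg k) i"
proof -
  show "zero (Ser k) = cls k 0"
    by (auto simp: Ser_def FactSuperalg_def FactRing_def mem_cls)
qed (auto simp: Ser_def FactSuperalg_def FactRing_def A_RCOSETS_def' cls_def)

lemma Ser_ops:
  assumes "p \<in> carrier (free_superalg k)"
  shows "q \<in> carrier (free_superalg k) \<Longrightarrow> cls k p \<otimes>\<^bsub>Ser k\<^esub> cls k q = cls k (p * q)"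
    and "q \<in> carrier (free_superalg k) \<Longrightarrow> cls k p \<oplus>\<^bsub>Ser k\<^esub> cls k q = cls k (p + q)"
    and "c \<odot>\<^bsub>Ser k\<^esub> cls k p = cls k (smul c p)"
proof -
  show "cls k p \<otimes>\<^bsub>Ser k\<^esub> cls k q = cls k (p * q)" if "q \<in> carrier (free_superalg k)"
    using ideal.rcoset_mult_add[OF ideal_sergeev assms that]
    by (simp add: Ser_def FactSuperalg_def FactRing_def cls_def)
  show "cls k p \<oplus>\<^bsub>Ser k\<^esub> cls k q = cls k (p + q)" if "q \<in> carrier (free_superalg k)"
    using ideal.a_rcos_sum[OF ideal_sergeev assms that]
    by (simp add: Ser_def FactSuperalg_def FactRing_def cls_def)
  \<comment> \<open>\<open>FactSuperalg\<close> takes a union over the representatives of the coset.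
    Its members all coincide by \<open>cls_smul_cong\<close>, and the coset is inhabited because the
    ideal contains 0.\<close>
  have "c \<odot>\<^bsub>Ser k\<^esub> cls k p = (\<Union>x\<in>cls k p. cls k (smul c x))"
    by (simp add: Ser_def FactSuperalg_def cls_def)
  also have "\<dots> = (\<Union>x\<in>cls k p. cls k (smul c p))"
    using assms mem_clsD[OF assms] by (intro SUP_cong cls_smul_cong) auto
  also have "\<dots> = cls k (smul c p)"
    using sergeev_ideal_0[of k] mem_cls[of p k p] by auto
  finally show "c \<odot>\<^bsub>Ser k\<^esub> cls k p = cls k (smul c p)" .
qed

lemma ring_Ser: "ring (Ser k)"
proof (intro ringI abelian_groupI monoidI)
  show "\<exists>y\<in>carrier (Ser k). y \<oplus>\<^bsub>Ser k\<^esub> x = \<zero>\<^bsub>Ser k\<^esub>" if "x \<in> carrier (Ser k)" for x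
  proof -
    from that obtain p where p: "p \<in> carrier (free_superalg k)" "x = cls k p"
      by (auto simp: Ser_simps)
    then show ?thesis
      by (intro bexI[of _ "cls k (- p)"]) (auto simp: Ser_simps Ser_ops)
  qed
qed (auto simp: Ser_simps Ser_ops algebra_simps)

lemma Ser_finsum:
  assumes "finite A" "\<And>x. x \<in> A \<Longrightarrow> f x \<in> carrier (free_superalg k)"
  shows "(\<Oplus>\<^bsub>Ser k\<^esub>x\<in>A. cls k (f x)) = cls k (sum f A)"
  using assms
proof (induction A rule: finite_induct)
  case empty
  interpret ring "Ser k" by (rule ring_Ser)
  show ?case by (simp add: Ser_simps)
next
  case (insert a A)
  interpret ring "Ser k" by (rule ring_Ser)
  show ?case using insert by (subst finsum_insert) (auto simp: Ser_simps Ser_ops)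
qed

lemma module_Ser: "module complex_field (Ser k)"
proof (intro moduleI cring_from_type_algebra)
  show "abelian_group (Ser k)" by (rule ring.is_abelian_group[OF ring_Ser])
qed (auto simp: Ser_simps Ser_ops smul_eq_mult ring_of_type_algebra_def algebra_simps
       single_add simp flip: single_append one_eq_single mult.assoc)

section \<open>Calculation with scaled monomials\<close>

lemma image_subset_gens [simp]:
  "gS ` A \<subseteq> gens k \<longleftrightarrow> A \<subseteq> {1..<k}" "gC ` B \<subseteq> gens k \<longleftrightarrow> B \<subseteq> {1..k}"
  by auto

text \<open>The scalar stays attached to the word, so that relations with a sign, such as the one
  for the square of \<open>gC i\<close>, are also equations between two such classes.\<close>

definition mon :: "nat \<Rightarrow> complex \<Rightarrow> gen list \<Rightarrow> (gen list \<Rightarrow>\<^sub>0 complex) set"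
  where "mon k a w = cls k (Poly_Mapping.single w a)"

lemma ser_monomial_eq_mon: "ser_monomial k w = mon k 1 w"
  by (simp add: ser_monomial_def mon_def cls_def)

lemma mon_mult:
  "\<lbrakk>set u \<subseteq> gens k; set v \<subseteq> gens k\<rbrakk> \<Longrightarrow> mon k a u \<otimes>\<^bsub>Ser k\<^esub> mon k b v = mon k (a * b) (u @ v)"
  by (simp add: mon_def Ser_ops single_append)

text \<open>Makes every relation usable inside a longer word; the outer scalar \<open>c\<close>
  carries the signs accumulated so far.\<close>

lemma mon_context:
  assumes "mon k a u = mon k b v" "set u \<subseteq> gens k" "set v \<subseteq> gens k" "set x \<subseteq> gens k" "set y \<subseteq> gens k"
  shows "mon k (c * a) (x @ u @ y) = mon k (c * b) (x @ v @ y)"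
proof -
  have "mon k (c * a) (x @ u @ y) = mon k c x \<otimes>\<^bsub>Ser k\<^esub> (mon k a u \<otimes>\<^bsub>Ser k\<^esub> mon k 1 y)"
    using assms(2-) by (simp add: mon_mult)
  also have "\<dots> = mon k (c * b) (x @ v @ y)"
    unfolding assms(1) using assms(2-) by (simp add: mon_mult)
  finally show ?thesis .
qed

lemma mon_relator:
  assumes "Poly_Mapping.single u 1 - Poly_Mapping.single v a \<in> sergeev_relators k"
    "set u \<subseteq> gens k" "set v \<subseteq> gens k"
  shows "mon k 1 u = mon k a v"
  unfolding mon_def using assms by (intro cls_relator) auto

lemma single_mult_words:
  "Poly_Mapping.single u a * Poly_Mapping.single v b = Poly_Mapping.single (u @ v) (a * b :: complex)"
  by (simp add: single_append)

section \<open>The defining relations as equations between words\<close>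

context
  fixes k :: nat
begin

lemma mon_S_square: "i \<in> {1..<k} \<Longrightarrow> mon k 1 [gS i, gS i] = mon k 1 []"
proof (rule mon_relator)
  assume "i \<in> {1..<k}"
  then have "fs i * fs i - 1 \<in> sergeev_relators k"
    unfolding sergeev_relators_def by blast
  then show "Poly_Mapping.single [gS i, gS i] 1 - Poly_Mapping.single [] 1 \<in> sergeev_relators k"
    by (simp add: single_mult_words one_eq_single)
qed auto

lemma mon_S_braid:
  "\<lbrakk>i \<in> {1..<k}; Suc i \<in> {1..<k}\<rbrakk>
    \<Longrightarrow> mon k 1 [gS i, gS (Suc i), gS i] = mon k 1 [gS (Suc i), gS i, gS (Suc i)]"
proof (rule mon_relator)
  assume "i \<in> {1..<k}" "Suc i \<in> {1..<k}"
  then have "i + 1 \<in> {1..<k}" by simp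
  with \<open>i \<in> {1..<k}\<close> have "fs i * fs (i + 1) * fs i - fs (i + 1) * fs i * fs (i + 1) \<in> sergeev_relators k"
    unfolding sergeev_relators_def by blast
  then show "Poly_Mapping.single [gS i, gS (Suc i), gS i] 1
      - Poly_Mapping.single [gS (Suc i), gS i, gS (Suc i)] 1 \<in> sergeev_relators k"
    by (simp add: single_mult_words)
qed auto

lemma mon_S_commute:
  "\<lbrakk>i \<in> {1..<k}; j \<in> {1..<k}; Suc i < j\<rbrakk> \<Longrightarrow> mon k 1 [gS i, gS j] = mon k 1 [gS j, gS i]"
proof (rule mon_relator)
  assume "i \<in> {1..<k}" "j \<in> {1..<k}" "Suc i < j"
  moreover from \<open>Suc i < j\<close> have "\<bar>int i - int j\<bar> > 1" by simp
  ultimately have "fs i * fs j - fs j * fs i \<in> sergeev_relators k"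
    unfolding sergeev_relators_def by blast
  then show "Poly_Mapping.single [gS i, gS j] 1 - Poly_Mapping.single [gS j, gS i] 1 \<in> sergeev_relators k"
    by (simp add: single_mult_words)
qed auto

lemma mon_C_square: "i \<in> {1..k} \<Longrightarrow> mon k 1 [gC i, gC i] = mon k (- 1) []"
proof (rule mon_relator)
  assume "i \<in> {1..k}"
  then have "fc i * fc i - (- 1) \<in> sergeev_relators k"
    unfolding sergeev_relators_def by blast
  then show "Poly_Mapping.single [gC i, gC i] 1 - Poly_Mapping.single [] (- 1) \<in> sergeev_relators k"
    by (simp add: single_mult_words one_eq_single single_uminus)
qed auto

lemma mon_C_anticommute:
  "\<lbrakk>i \<in> {1..k}; j \<in> {1..k}; i \<noteq> j\<rbrakk> \<Longrightarrow> mon k 1 [gC i, gC j] = mon k (- 1) [gC j, gC i]"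
proof (rule mon_relator)
  assume "i \<in> {1..k}" "j \<in> {1..k}" "i \<noteq> j"
  then have "fc i * fc j - (- (fc j * fc i)) \<in> sergeev_relators k"
    unfolding sergeev_relators_def by blast
  then show "Poly_Mapping.single [gC i, gC j] 1 - Poly_Mapping.single [gC j, gC i] (- 1) \<in> sergeev_relators k"
    by (simp add: single_mult_words one_eq_single single_uminus)
qed auto

lemma mon_SCS: "i \<in> {1..<k} \<Longrightarrow> mon k 1 [gS i, gC i, gS i] = mon k 1 [gC (Suc i)]"
proof (rule mon_relator)
  assume "i \<in> {1..<k}"
  then have "fs i * fc i * fs i - fc (i + 1) \<in> sergeev_relators k"
    unfolding sergeev_relators_def by blast
  then show "Poly_Mapping.single [gS i, gC i, gS i] 1 - Poly_Mapping.single [gC (Suc i)] 1 \<in> sergeev_relators k"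
    by (simp add: single_mult_words)
qed auto

lemma mon_SC_commute:
  "\<lbrakk>i \<in> {1..<k}; j \<in> {1..k}; j \<noteq> i; j \<noteq> Suc i\<rbrakk> \<Longrightarrow> mon k 1 [gS i, gC j] = mon k 1 [gC j, gS i]"
proof (rule mon_relator)
  assume "i \<in> {1..<k}" "j \<in> {1..k}" "j \<noteq> i" "j \<noteq> Suc i"
  moreover from \<open>j \<noteq> Suc i\<close> have "j \<noteq> i + 1" by simp
  ultimately have "fs i * fc j - fc j * fs i \<in> sergeev_relators k"
    unfolding sergeev_relators_def by blast
  then show "Poly_Mapping.single [gS i, gC j] 1 - Poly_Mapping.single [gC j, gS i] 1 \<in> sergeev_relators k"
    by (simp add: single_mult_words)
qed auto

text \<open>The presentation relates c_i and c_{i+1} only through s_i c_i s_i = c_{i+1}. Multiplying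
  by s_i on the left and cancelling its square gives the case \<open>x = i\<close>, on the right the
  case \<open>x = Suc i\<close>.\<close>

lemma mon_CS:
  assumes "i \<in> {1..<k}" "x \<in> {1..k}"
  shows "mon k 1 [gC x, gS i] = mon k 1 [gS i, gC (transpose i (Suc i) x)]"
proof -
  consider "x = i" | "x = Suc i" | "x \<noteq> i" "x \<noteq> Suc i" by blast
  then show ?thesis
  proof cases
    case 1
    have "mon k 1 [gC i, gS i] = mon k 1 [gS i, gS i, gC i, gS i]"
      using mon_context[OF mon_S_square[OF assms(1)], of "[]" "[gC i, gS i]" 1] assms 1 by simp
    also have "\<dots> = mon k 1 [gS i, gC (Suc i)]"
      using mon_context[OF mon_SCS[OF assms(1)], of "[gS i]" "[]" 1] assms by simp
    finally show ?thesis using 1 by simp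
  next
    case 2
    have "mon k 1 [gC (Suc i), gS i] = mon k 1 [gS i, gC i, gS i, gS i]"
      using mon_context[OF mon_SCS[OF assms(1)], of "[]" "[gS i]" 1] assms by simp
    also have "\<dots> = mon k 1 [gS i, gC i]"
      using mon_context[OF mon_S_square[OF assms(1)], of "[gS i, gC i]" "[]" 1] assms by simp
    finally show ?thesis using 2 by simp
  next
    case 3
    then show ?thesis using mon_SC_commute[of i x] assms by (simp add: transpose_def)
  qed
qed

lemma mon_cox: "cox k u v \<Longrightarrow> mon k 1 (map gS u) = mon k 1 (map gS v)"
proof (induction rule: cox.induct)
  case (square a i b)
  then show ?case
    using mon_context[OF mon_S_square[of i], of "map gS a" "map gS b" 1] by simp
next
  case (braid a i b)
  then show ?case
    using mon_context[OF mon_S_braid[of i], of "map gS a" "map gS b" 1] by simp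
next
  case (commute a i j b)
  then show ?case
    using mon_context[OF mon_S_commute[of i j], of "map gS a" "map gS b" 1] by simp
qed auto

text \<open>Existence in the definite description is witnessed by the given word; uniqueness is
  \<open>cox_complete\<close> transported to the quotient by \<open>mon_cox\<close>.\<close>

lemma ser_perm_eq:
  assumes "set js \<subseteq> {1..<k}"
  shows "ser_perm k (transposition_prod js) = mon k 1 (map gS js)"
  unfolding ser_perm_def ser_monomial_eq_mon
  using assms by (intro the_equality) (auto simp del: One_nat_def intro!: mon_cox cox_complete)

lemma mon_C_perm:
  assumes "set js \<subseteq> {1..<k}" "x \<in> {1..k}"
  shows "mon k 1 (gC x # map gS js) = mon k 1 (map gS js @ [gC (inv (transposition_prod js) x)])"
  using assms
proof (induction js arbitrary: x)
  case Nil
  then show ?case by simp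
next
  case (Cons j js)
  let ?t = "transpose j (Suc j)"
  have j: "j \<in> {1..<k}" and tx: "?t x \<in> {1..k}"
    using Cons.prems by (auto simp: transpose_def)
  have "mon k 1 (gC x # map gS (j # js)) = mon k 1 ([gS j] @ (gC (?t x) # map gS js))"
    using mon_context[OF mon_CS[OF j Cons.prems(2)], of "[]" "map gS js" 1] Cons.prems j tx
    by simp
  also have "\<dots> = mon k 1 ([gS j] @ (map gS js @ [gC (inv (transposition_prod js) (?t x))]))"
    using mon_context[OF Cons.IH[of "?t x"], of "[gS j]" "[]" 1] Cons.prems j tx
      permutes_in_image[OF permutes_inv[OF transposition_prod_permutes], of js k "?t x"] by simp
  also have "inv (transposition_prod js) (?t x) = inv (transposition_prod (j # js)) x"
    by (simp add: o_inv_distrib bij_transposition_prod)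
  finally show ?case by (simp only: list.map append_Cons append_Nil)
qed

lemma mon_Cs_perm:
  assumes "set js \<subseteq> {1..<k}" "set xs \<subseteq> {1..k}"
  shows "mon k 1 (map gC xs @ map gS js)
    = mon k 1 (map gS js @ map gC (map (inv (transposition_prod js)) xs))"
  using assms
proof (induction xs)
  case (Cons x xs)
  let ?i = "inv (transposition_prod js)"
  have *: "?i y \<in> {1..k}" if "y \<in> {1..k}" for y
    using that permutes_in_image[OF permutes_inv[OF transposition_prod_permutes], of js k] Cons.prems by blast
  then have **: "set (map ?i xs) \<subseteq> {1..k}" using Cons.prems by auto
  have "mon k 1 (map gC (x # xs) @ map gS js) = mon k 1 ([gC x] @ (map gS js @ map gC (map ?i xs)))"
    using mon_context[OF Cons.IH, of "[gC x]" "[]" 1] Cons.prems ** by (simp del: map_map)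
  also have "\<dots> = mon k 1 ((map gS js @ [gC (?i x)]) @ map gC (map ?i xs))"
    using mon_context[OF mon_C_perm[of js x], of "[]" "map gC (map ?i xs)" 1] Cons.prems ** *[of x]
    by (simp del: map_map)
  finally show ?case by simp
qed simp

end

section \<open>Sorting Clifford generators\<close>

abbreviation slist :: "nat set \<Rightarrow> nat list"
  where "slist \<equiv> sorted_list_of_set"

lemma sorted_list_of_set_insert_less:
  assumes "finite A" "\<And>a. a \<in> A \<Longrightarrow> x < a"
  shows "sorted_list_of_set (insert x A) = (x :: nat) # sorted_list_of_set A"
proof -
  have "x \<notin> A" using assms(2) by blast
  then have "length (x # sorted_list_of_set A) = card (insert x A)"
    using assms(1) by simp
  then show ?thesis
    using assms sorted_list_of_set_unique[of "insert x A" "x # sorted_list_of_set A"] by auto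
qed

lemma card_sym_diff_even:
  assumes "finite A" "finite B"
  shows "even (card (sym_diff A B)) \<longleftrightarrow> even (card A + card B)"
proof -
  have "card (sym_diff A B) = card (A - B) + card (B - A)"
    using assms by (intro card_Un_disjoint) auto
  moreover have "card A = card (A \<inter> B) + card (A - B)" "card B = card (B \<inter> A) + card (B - A)"
    using assms by (auto intro: card_Int_Diff)
  ultimately show ?thesis by (simp add: Int_commute) blast
qed

lemma minus_one_power_eqI: "(even m \<longleftrightarrow> even n) \<Longrightarrow> (- 1 :: complex) ^ m = (- 1) ^ n"
  by (simp add: minus_one_power_iff)

text \<open>Inversions that use position 0 are counted by the filter; the others are those of
  \<open>ys\<close> with both positions shifted by one.\<close>

lemma arranging_number_Cons:
  "arranging_number (x # ys) = length (filter (\<lambda>y. y < x) ys) + arranging_number ys"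
proof -
  let ?A = "{v. v < length ys \<and> ys ! v < x}"
  let ?B = "{(u, v). u < v \<and> v < length ys \<and> ys ! u > ys ! v}"
  have "{(u, v). u < v \<and> v < length (x # ys) \<and> (x # ys) ! u > (x # ys) ! v}
      = (\<lambda>v. (0, Suc v)) ` ?A \<union> map_prod Suc Suc ` ?B" (is "?L = ?R")
  proof -
    have "(u, v) \<in> ?L \<longleftrightarrow> (u, v) \<in> ?R" for u v
      by (cases u; cases v) (auto simp: image_iff)
    then show ?thesis by auto
  qed
  moreover have "finite ?B"
    by (rule finite_subset[of _ "{..<length ys} \<times> {..<length ys}"]) auto
  moreover have "card ((\<lambda>v. (0 :: nat, Suc v)) ` ?A) = card ?A"
    by (intro card_image) (auto simp: inj_on_def)
  moreover have "card (map_prod Suc Suc ` ?B) = card ?B"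
    by (intro card_image) (auto simp: inj_on_def)
  moreover have "card ((\<lambda>v. (0 :: nat, Suc v)) ` ?A \<union> map_prod Suc Suc ` ?B)
      = card ((\<lambda>v. (0 :: nat, Suc v)) ` ?A) + card (map_prod Suc Suc ` ?B)"
    using \<open>finite ?B\<close> by (intro card_Un_disjoint) auto
  ultimately have "arranging_number (x # ys) = card ?A + arranging_number ys"
    unfolding arranging_number_def by (simp only:)
  then show ?thesis by (simp add: length_filter_conv_card)
qed

lemma arranging_number_sorted: "sorted xs \<Longrightarrow> arranging_number xs = 0"
proof (induction xs)
  case Nil
  show ?case by (simp add: arranging_number_def)
next
  case (Cons x xs)
  then have "filter (\<lambda>y. y < x) xs = []" by (auto simp: filter_empty_conv not_less)
  with Cons show ?case by (simp add: arranging_number_Cons)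
qed

text \<open>Moving c_a to its sorted place passes every smaller letter at the cost of -1 each. If
  \<open>a\<close> is already present, the two copies meet and square to -1, one further sign, and
  both disappear; hence the count up to and including \<open>a\<close>, and the symmetric
  difference.\<close>

lemma mon_C_sorted:
  assumes "a \<in> {1..k}" "J \<subseteq> {1..k}"
  shows "mon k 1 (gC a # map gC (slist J))
    = mon k ((- 1) ^ card {b \<in> J. b \<le> a}) (map gC (slist (sym_diff J {a})))"
proof -
  have "finite J" using assms finite_subset by blast
  then show ?thesis using assms(2)
  \<comment> \<open>Each step adds a new minimum, which heads the sorted list and is therefore the
    letter that \<open>gC a\<close> meets.\<close>
  proof (induction J rule: finite_linorder_min_induct)
    case empty
    then show ?case by simp
  next
    case (insert b A)
    have A: "set (slist A) \<subseteq> {1..k}" "b \<notin> A" "b \<in> {1..k}" using insert by auto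
    have sb: "slist (insert b A) = b # slist A"
      using insert by (intro sorted_list_of_set_insert_less) auto
    consider "a < b" | "a = b" | "b < a" by linarith
    then show ?case
    proof cases
      case 1
      have "{c \<in> insert b A. c \<le> a} = {}" using 1 insert by fastforce
      then have "card {c \<in> insert b A. c \<le> a} = 0" by simp
      moreover have "sym_diff (insert b A) {a} = insert a (insert b A)" using 1 insert by fastforce
      moreover have "slist (insert a (insert b A)) = a # slist (insert b A)"
        using 1 insert by (intro sorted_list_of_set_insert_less) fastforce+
      ultimately show ?thesis by (simp only: power_0 list.map)
    next
      case 2
      have "{c \<in> insert b A. c \<le> a} = {a}" using 2 insert by fastforce
      moreover have "sym_diff (insert b A) {a} = A" using 2 A by auto
      ultimately show ?thesis
        using mon_context[OF mon_C_square[OF assms(1)], of "[]" "map gC (slist A)" 1] assms A sb 2 by simp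
    next
      case 3
      have fin: "finite {c \<in> A. c \<le> a}" using insert by simp
      have "{c \<in> insert b A. c \<le> a} = insert b {c \<in> A. c \<le> a}" using 3 by auto
      then have c: "card {c \<in> insert b A. c \<le> a} = Suc (card {c \<in> A. c \<le> a})" using A fin by simp
      have "sym_diff (insert b A) {a} = insert b (sym_diff A {a})" using 3 A by auto
      moreover have "slist (insert b (sym_diff A {a})) = b # slist (sym_diff A {a})"
        using 3 insert by (intro sorted_list_of_set_insert_less) auto
      ultimately have s: "slist (sym_diff (insert b A) {a}) = b # slist (sym_diff A {a})" by simp
      have S: "set (slist (sym_diff A {a})) \<subseteq> {1..k}" using insert assms by auto
      have "mon k 1 (gC a # map gC (slist (insert b A)))
          = mon k (- 1) ([gC b] @ (gC a # map gC (slist A)))"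
        using mon_context[OF mon_C_anticommute[of a k b], of "[]" "map gC (slist A)" 1] assms A sb 3 by simp
      also have "\<dots> = mon k (- 1 * (- 1) ^ card {c \<in> A. c \<le> a})
          ([gC b] @ map gC (slist (sym_diff A {a})))"
        using mon_context[OF insert.IH, of "[gC b]" "[]" "- 1"] assms A S insert.prems by simp
      finally show ?thesis unfolding c s by simp
    qed
  qed
qed

text \<open>The letters of \<open>xs\<close> are inserted from the right, each by
  \<open>mon_C_sorted\<close>. The set reached so far has lost the pairs that were annihilated, so
  its count agrees with the inversion count only modulo 2, which is all that the sign sees. Each
  common letter contributes one more sign for its square.\<close>

theorem mon_Cs_sorted:
  assumes "distinct xs" "set xs \<subseteq> {1..k}" "J \<subseteq> {1..k}"
  shows "mon k 1 (map gC xs @ map gC (slist J))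
    = mon k ((- 1) ^ (card (set xs \<inter> J) + arranging_number (xs @ slist J)))
        (map gC (slist (sym_diff (set xs) J)))"
  using assms
proof (induction xs)
  case Nil
  then show ?case by (simp add: arranging_number_sorted)
next
  case (Cons x xs)
  have fin: "finite J" using assms finite_subset by blast
  define T where "T = sym_diff (set xs) J"
  have T: "T \<subseteq> {1..k}" "finite T" "set (slist T) \<subseteq> {1..k}"
    using Cons.prems fin by (auto simp: T_def)
  have Tx: "T - {x} \<subseteq> {Suc 0..k} \<and> {x} - T \<subseteq> {Suc 0..k}"
    using Cons.prems T by auto
  have set_eq: "sym_diff T {x} = sym_diff (set (x # xs)) J"
    using Cons.prems by (auto simp: T_def)
  let ?m = "card (set xs \<inter> J) + arranging_number (xs @ slist J)"
  have "mon k 1 (map gC (x # xs) @ map gC (slist J)) = mon k ((- 1) ^ ?m) (gC x # map gC (slist T))"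
    using mon_context[OF Cons.IH, of "[gC x]" "[]" 1, folded T_def] Cons.prems T fin by simp
  also have "\<dots> = mon k ((- 1) ^ ?m * (- 1) ^ card {b \<in> T. b \<le> x}) (map gC (slist (sym_diff T {x})))"
    using mon_context[OF mon_C_sorted[of x k T], of "[]" "[]" "(- 1) ^ ?m"] Cons.prems T Tx by simp
  also have "(- 1 :: complex) ^ ?m * (- 1) ^ card {b \<in> T. b \<le> x}
      = (- 1) ^ (card (set (x # xs) \<inter> J) + arranging_number ((x # xs) @ slist J))"
    unfolding power_add[symmetric]
  proof (rule minus_one_power_eqI)
    let ?X = "{b \<in> set xs. b < x}" and ?Y = "{b \<in> J. b < x}"
    \<comment> \<open>Letters below \<open>x\<close> common to \<open>xs\<close> and
      \<open>J\<close> have cancelled from \<open>T\<close>, but each gives two inversions of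
      \<open>x\<close>.\<close>
    have "{b \<in> T. b < x} = sym_diff ?X ?Y" by (auto simp: T_def)
    then have 1: "even (card {b \<in> T. b < x}) \<longleftrightarrow> even (card ?X + card ?Y)"
      using card_sym_diff_even[of ?X ?Y] fin by simp
    \<comment> \<open>As \<open>x\<close> does not occur in \<open>xs\<close>, it lies in
      \<open>T\<close> exactly when it lies in \<open>J\<close>; this is the extra sign of a
      square.\<close>
    have "{b \<in> T. b \<le> x} = {b \<in> T. b < x} \<union> ({x} \<inter> J)" using Cons.prems by (auto simp: T_def le_less)
    moreover have "card ({b \<in> T. b < x} \<union> ({x} \<inter> J)) = card {b \<in> T. b < x} + card ({x} \<inter> J)"
      using T by (intro card_Un_disjoint) auto
    ultimately have 2: "card {b \<in> T. b \<le> x} = card {b \<in> T. b < x} + card ({x} \<inter> J)" by simp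
    have "set (x # xs) \<inter> J = (set xs \<inter> J) \<union> ({x} \<inter> J)" by auto
    moreover have "card ((set xs \<inter> J) \<union> ({x} \<inter> J)) = card (set xs \<inter> J) + card ({x} \<inter> J)"
      using Cons.prems by (intro card_Un_disjoint) auto
    ultimately have 3: "card (set (x # xs) \<inter> J) = card (set xs \<inter> J) + card ({x} \<inter> J)" by simp
    have count: "length (filter (\<lambda>y. y < x) ys) = card {b \<in> set ys. b < x}" if "distinct ys" for ys
      using that by (metis distinct_card distinct_filter set_filter)
    have 4: "arranging_number ((x # xs) @ slist J)
        = card ?X + card ?Y + arranging_number (xs @ slist J)"
      using Cons.prems fin by (simp add: arranging_number_Cons count)
    show "even (?m + card {b \<in> T. b \<le> x})
        \<longleftrightarrow> even (card (set (x # xs) \<inter> J) + arranging_number ((x # xs) @ slist J))"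
      unfolding 2 3 4 using 1 by simp blast
  qed
  finally show ?case unfolding set_eq .
qed

section \<open>A representation on functions\<close>

text \<open>
  The coefficient at \<open>(\<tau>, I)\<close> stands for the basis element \<open>\<tau>\<^sup>-\<^sup>1 c\<^sub>I\<close>. On functions the left
  regular action becomes an anti-representation, so \<open>fold act\<close> applies the first letter of a word
  first. Only functions supported on injective \<open>\<tau>\<close> are considered, since the anticommutation of
  \<open>c\<^sub>i\<close> and \<open>c\<^sub>j\<close> needs \<open>\<tau> i \<noteq> \<tau> j\<close>.
\<close>

type_synonym vec = "(nat \<Rightarrow> nat) \<Rightarrow> nat set \<Rightarrow> complex"

definition sgn_upto :: "nat set \<Rightarrow> nat \<Rightarrow> complex"
  where "sgn_upto I n = (- 1) ^ card {b \<in> I. b \<le> n}"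

text \<open>Left multiplication by \<open>g\<close> is carried out on the basis element and the
  result is read by \<open>f\<close>. The letter c_i crosses the inverse of \<open>\<tau>\<close>
  and becomes the letter with index \<open>\<tau> i\<close>, which is then sorted into
  \<open>I\<close> with the sign and the symmetric difference of
  \<open>mon_C_sorted\<close>.\<close>

fun act :: "gen \<Rightarrow> vec \<Rightarrow> vec" where
  "act (gS i) f = (\<lambda>\<tau> I. f (\<tau> \<circ> transpose i (Suc i)) I)"
| "act (gC i) f = (\<lambda>\<tau> I. sgn_upto I (\<tau> i) * f \<tau> (sym_diff I {\<tau> i}))"

definition poly_act :: "(gen list \<Rightarrow>\<^sub>0 complex) \<Rightarrow> vec \<Rightarrow> vec"
  where "poly_act p f = (\<lambda>\<tau> I. \<Sum>w\<in>Poly_Mapping.keys p. Poly_Mapping.lookup p w * fold act w f \<tau> I)"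

lemma poly_act_superset:
  assumes "finite A" "Poly_Mapping.keys p \<subseteq> A"
  shows "poly_act p f \<tau> I = (\<Sum>w\<in>A. Poly_Mapping.lookup p w * fold act w f \<tau> I)"
  unfolding poly_act_def using assms by (intro sum.mono_neutral_left) (auto simp: in_keys_iff)

lemma poly_act_0 [simp]: "poly_act 0 f \<tau> I = 0"
  by (simp add: poly_act_def)

lemma poly_act_single [simp]: "poly_act (Poly_Mapping.single w a) f \<tau> I = a * fold act w f \<tau> I"
  by (subst poly_act_superset[of "{w}"]) auto

lemma poly_act_add [simp]: "poly_act (p + q) f \<tau> I = poly_act p f \<tau> I + poly_act q f \<tau> I"
proof -
  let ?A = "Poly_Mapping.keys p \<union> Poly_Mapping.keys q"
  have "poly_act r f \<tau> I = (\<Sum>w\<in>?A. Poly_Mapping.lookup r w * fold act w f \<tau> I)"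
    if "r = p \<or> r = q \<or> r = p + q" for r
    using that keys_add[of p q] by (intro poly_act_superset) auto
  then show ?thesis by (simp add: lookup_add algebra_simps sum.distrib)
qed

lemma poly_act_uminus [simp]: "poly_act (- p) f \<tau> I = - poly_act p f \<tau> I"
  using poly_act_add[of p "- p" f \<tau> I] by (simp add: eq_neg_iff_add_eq_0 add.commute)

lemma poly_act_diff [simp]: "poly_act (p - q) f \<tau> I = poly_act p f \<tau> I - poly_act q f \<tau> I"
  using poly_act_add[of p "- q" f \<tau> I] by simp

lemma poly_act_sum [simp]: "poly_act (sum g A) f \<tau> I = (\<Sum>x\<in>A. poly_act (g x) f \<tau> I)"
  by (induction A rule: infinite_finite_induct) auto

lemma act_linear:
  "act g (\<lambda>\<tau> I. \<Sum>x\<in>A. c x * f x \<tau> I) = (\<lambda>\<tau> I. \<Sum>x\<in>A. c x * act g (f x) \<tau> I)"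
  by (cases g) (auto simp: sum_distrib_left fun_eq_iff algebra_simps)

lemma fold_act_linear:
  "fold act w (\<lambda>\<tau> I. \<Sum>x\<in>A. c x * f x \<tau> I) = (\<lambda>\<tau> I. \<Sum>x\<in>A. c x * fold act w (f x) \<tau> I)"
  by (induction w arbitrary: f) (simp_all add: act_linear)

lemma poly_act_mult: "poly_act (p * q) f = poly_act q (poly_act p f)"
proof (intro ext)
  fix \<tau> I
  have "p * q = (\<Sum>v\<in>Poly_Mapping.keys q. \<Sum>u\<in>Poly_Mapping.keys p.
      Poly_Mapping.single (u @ v) (Poly_Mapping.lookup p u * Poly_Mapping.lookup q v))"
    using poly_mapping_sum_single[of "Poly_Mapping.keys p" p]
      poly_mapping_sum_single[of "Poly_Mapping.keys q" q]
    unfolding single_append by (simp flip: sum_distrib_left sum_distrib_right)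
  then have "poly_act (p * q) f \<tau> I = (\<Sum>v\<in>Poly_Mapping.keys q. \<Sum>u\<in>Poly_Mapping.keys p.
      Poly_Mapping.lookup p u * Poly_Mapping.lookup q v * fold act v (fold act u f) \<tau> I)"
    by simp
  also have "\<dots> = poly_act q (poly_act p f) \<tau> I"
    unfolding poly_act_def fold_act_linear by (simp add: sum_distrib_left algebra_simps)
  finally show "poly_act (p * q) f \<tau> I = poly_act q (poly_act p f) \<tau> I" .
qed

section \<open>Functions with injective support and the kernel of the action\<close>

definition inj_supported :: "vec \<Rightarrow> bool"
  where "inj_supported f \<longleftrightarrow> (\<forall>\<tau> I. \<not> inj \<tau> \<longrightarrow> f \<tau> I = 0)"

lemma inj_supported_act: "inj_supported f \<Longrightarrow> inj_supported (act g f)"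
proof (cases g)
  case (gS i)
  assume "inj_supported f"
  moreover have "inj \<tau>" if "inj (\<tau> \<circ> transpose i (Suc i))" for \<tau> :: "nat \<Rightarrow> nat"
    using inj_compose[OF that inj_transpose[of i "Suc i"]] by (simp add: comp_assoc)
  ultimately show ?thesis by (auto simp: inj_supported_def gS)
qed (auto simp: inj_supported_def)

lemma inj_supported_poly_act: "inj_supported f \<Longrightarrow> inj_supported (poly_act p f)"
proof -
  assume "inj_supported f"
  then have "inj_supported (fold act w f)" for w
    by (induction w arbitrary: f) (auto intro: inj_supported_act)
  then show ?thesis by (simp add: inj_supported_def poly_act_def)
qed

definition rep_kernel :: "nat \<Rightarrow> (gen list \<Rightarrow>\<^sub>0 complex) set"
  where "rep_kernel k = {p \<in> carrier (free_superalg k). \<forall>f. inj_supported f \<longrightarrow> poly_act p f = (\<lambda>_ _. 0)}"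

lemma fold_act_zero [simp]: "fold act w (\<lambda>_ _. 0) = (\<lambda>_ _. 0)"
  using fold_act_linear[of w "\<lambda>_. 0" "\<lambda>_ _ _. 0" "{}"] by simp

lemma poly_act_zero [simp]: "poly_act p (\<lambda>_ _. 0) = (\<lambda>_ _. 0)"
  by (simp add: poly_act_def)

text \<open>A right factor acts on a function that is already zero; a left factor acts earlier and
  returns a function that is again \<open>inj_supported\<close>. Hence the kernel absorbs products
  on both sides.\<close>

lemma ideal_rep_kernel: "ideal (rep_kernel k) (free_superalg k)"
proof (rule idealI[OF ring_free])
  interpret ring "free_superalg k" by (rule ring_free)
  show "subgroup (rep_kernel k) (add_monoid (free_superalg k))"
  proof (rule group.subgroupI[OF a_group])
    show "rep_kernel k \<noteq> {}"
      by (auto simp: rep_kernel_def fun_eq_iff intro!: exI[of _ 0])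
    show "m_inv (add_monoid (free_superalg k)) p \<in> rep_kernel k" if "p \<in> rep_kernel k" for p
    proof -
      have "m_inv (add_monoid (free_superalg k)) p = - p"
        using that a_inv_free[of p k] unfolding a_inv_def rep_kernel_def by blast
      then show ?thesis
        using that unfolding rep_kernel_def by (simp add: fun_eq_iff)
    qed
  qed (auto simp: rep_kernel_def fun_eq_iff)
qed (auto simp: rep_kernel_def poly_act_mult inj_supported_poly_act)

lemma rep_kernel_relator:
  assumes "set u \<subseteq> gens k" "set v \<subseteq> gens k"
    and "\<And>f \<tau> I. inj_supported f \<Longrightarrow> fold act u f \<tau> I = a * fold act v f \<tau> I"
  shows "Poly_Mapping.single u 1 - Poly_Mapping.single v a \<in> rep_kernel k"
  using assms by (auto simp: rep_kernel_def fun_eq_iff)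

lemma sgn_upto_sym_diff:
  "sgn_upto (sym_diff I {m}) n = (if m \<le> n then - sgn_upto I n else sgn_upto I n)"
proof (cases "m \<le> n")
  case True
  have "{b \<in> sym_diff I {m}. b \<le> n} = sym_diff {b \<in> I. b \<le> n} {m}" using True by auto
  then show ?thesis
    using True card_sym_diff_even[of "{b \<in> I. b \<le> n}" "{m}"] finite_subset[of "{b \<in> I. b \<le> n}" "{..n}"]
    by (auto simp: sgn_upto_def minus_one_power_iff)
next
  case False
  then have "{b \<in> sym_diff I {m}. b \<le> n} = {b \<in> I. b \<le> n}" by auto
  then show ?thesis using False by (simp add: sgn_upto_def)
qed

lemma sgn_upto_square [simp]: "sgn_upto I n * sgn_upto I n = 1"
  by (simp add: sgn_upto_def flip: power_add)

lemma act_C_square: "act (gC i) (act (gC i) f) \<tau> I = - f \<tau> I"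
proof -
  have "sym_diff (sym_diff I {\<tau> i}) {\<tau> i} = I" by auto
  then show ?thesis by (simp add: sgn_upto_sym_diff mult.assoc[symmetric] del: mult_minus_left)
qed

text \<open>Toggling one index changes the sign attached to the other exactly when the toggled one
  is not larger. As \<open>\<tau> i\<close> and \<open>\<tau> j\<close> differ, exactly one of the
  two orders picks up this extra sign.\<close>

lemma act_C_anticommute:
  assumes "inj_supported f" "i \<noteq> j"
  shows "act (gC j) (act (gC i) f) \<tau> I = - act (gC i) (act (gC j) f) \<tau> I"
proof (cases "inj \<tau>")
  case True
  then have "\<tau> i \<noteq> \<tau> j" using assms by (auto dest: injD)
  moreover have "sym_diff (sym_diff I {\<tau> j}) {\<tau> i} = sym_diff (sym_diff I {\<tau> i}) {\<tau> j}" by auto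
  ultimately show ?thesis by (cases "\<tau> i \<le> \<tau> j") (auto simp: sgn_upto_sym_diff)
next
  case False
  then show ?thesis using assms by (simp add: inj_supported_def)
qed

lemma sergeev_relators_rep_kernel: "sergeev_relators k \<subseteq> rep_kernel k"
proof -
  \<comment> \<open>These rewrites turn each relator into a difference of two scaled words, the
    shape of \<open>rep_kernel_relator\<close>.\<close>
  note simps = single_mult_words one_eq_single single_uminus[symmetric] append_Cons append_Nil mult_1
  have "fs i * fs i - 1 \<in> rep_kernel k" if "i \<in> {1..<k}" for i
    unfolding simps by (rule rep_kernel_relator) (use that in \<open>auto simp: comp_assoc\<close>)
  moreover have "fs i * fs (i + 1) * fs i - fs (i + 1) * fs i * fs (i + 1) \<in> rep_kernel k"
    if "i \<in> {1..<k}" "i + 1 \<in> {1..<k}" for i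
  proof -
    have "\<tau> \<circ> transpose i (Suc i) \<circ> transpose (Suc i) (Suc (Suc i)) \<circ> transpose i (Suc i)
      = \<tau> \<circ> transpose (Suc i) (Suc (Suc i)) \<circ> transpose i (Suc i) \<circ> transpose (Suc i) (Suc (Suc i))"
      for \<tau> :: "nat \<Rightarrow> nat"
      by (auto simp: fun_eq_iff transpose_def)
    then show ?thesis unfolding simps by (intro rep_kernel_relator) (use that in auto)
  qed
  moreover have "fs i * fs j - fs j * fs i \<in> rep_kernel k"
    if "i \<in> {1..<k}" "j \<in> {1..<k}" "\<bar>int i - int j\<bar> > 1" for i j
  proof -
    have "\<tau> \<circ> transpose i (Suc i) \<circ> transpose j (Suc j) = \<tau> \<circ> transpose j (Suc j) \<circ> transpose i (Suc i)"
      for \<tau> :: "nat \<Rightarrow> nat"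
      using that(3) by (auto simp: fun_eq_iff transpose_def)
    then show ?thesis unfolding simps by (intro rep_kernel_relator) (use that in auto)
  qed
  moreover have "fc i * fc i - (- 1) \<in> rep_kernel k" if "i \<in> {1..k}" for i
    unfolding simps by (rule rep_kernel_relator) (use that in \<open>auto simp: act_C_square simp del: act.simps\<close>)
  moreover have "fc i * fc j - (- (fc j * fc i)) \<in> rep_kernel k"
    if "i \<in> {1..k}" "j \<in> {1..k}" "i \<noteq> j" for i j
    unfolding simps by (rule rep_kernel_relator)
      (use that in \<open>auto simp: act_C_anticommute[of _ i j] simp del: act.simps\<close>)
  moreover have "fs i * fc i * fs i - fc (i + 1) \<in> rep_kernel k" if "i \<in> {1..<k}" for i
    unfolding simps by (rule rep_kernel_relator) (use that in \<open>auto simp: comp_assoc\<close>)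
  moreover have "fs i * fc j - fc j * fs i \<in> rep_kernel k"
    if "i \<in> {1..<k}" "j \<in> {1..k}" "j \<noteq> i" "j \<noteq> i + 1" for i j
    unfolding simps by (rule rep_kernel_relator) (use that in \<open>auto simp: transpose_def\<close>)
  ultimately show ?thesis unfolding sergeev_relators_def by blast
qed

lemma sergeev_ideal_rep_kernel: "sergeev_ideal k \<subseteq> rep_kernel k"
  unfolding sergeev_ideal_def
  by (rule ring.genideal_minimal[OF ring_free ideal_rep_kernel sergeev_relators_rep_kernel])

text \<open>Each letter puts its transposition to the right of \<open>\<tau>\<close>, later letters
  closer to \<open>\<tau>\<close> than earlier ones; the product that results is the reversed word,
  that is, the inverse permutation.\<close>

lemma fold_act_S: "fold act (map gS js) f \<tau> I = f (\<tau> \<circ> inv (transposition_prod js)) I"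
proof (induction js arbitrary: f)
  case (Cons j js)
  have "inv (transposition_prod (j # js)) = inv (transposition_prod js) \<circ> transpose j (Suc j)"
    by (simp add: o_inv_distrib bij_transposition_prod del: o_apply)
  with Cons show ?case by (simp only: fold_simps list.map act.simps comp_assoc)
qed simp

text \<open>Seen from the empty set the letters enter from the right of the word, in decreasing
  order, each below everything already present, so no sign arises.\<close>

lemma fold_act_C: "sorted_wrt (<) xs \<Longrightarrow> fold act (map gC xs) f id {} = f id (set xs)"
proof (induction xs arbitrary: f)
  case (Cons x xs)
  then have "{b \<in> set xs. b \<le> x} = {}" by fastforce
  then have "sgn_upto (set xs) x = 1" by (simp only: sgn_upto_def card.empty power_0)
  moreover have "sym_diff (set xs) {x} = set (x # xs)" using Cons.prems by auto
  ultimately show ?case using Cons by simp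
qed simp

lemma fold_act_SC:
  assumes "finite I"
  shows "fold act (map gS js @ map gC (slist I)) f id {} = f (inv (transposition_prod js)) I"
  using assms by (simp add: fold_act_C fold_act_S)

section \<open>Superdiagrams as marked permutations\<close>

text \<open>Marked edges are stored by their top vertices, the indexing used by both
  \<open>phi\<close> and \<open>ell\<close>.\<close>

definition diag :: "nat \<Rightarrow> (nat \<Rightarrow> nat) \<Rightarrow> nat set \<Rightarrow> superdiagram"
  where "diag k \<sigma> I = \<lparr>edges = (\<lambda>i. (i, \<sigma> i)) ` {1..k}, marked = (\<lambda>i. (i, \<sigma> i)) ` I\<rparr>"

lemma diag_in_superdiagrams:
  assumes "\<sigma> permutes {1..k}" "I \<subseteq> {1..k}"
  shows "diag k \<sigma> I \<in> superdiagrams k"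
proof -
  have "\<exists>!i. (i, j) \<in> (\<lambda>i. (i, \<sigma> i)) ` {1..k}" if "j \<in> {1..k}" for j
  proof (rule ex1I[of _ "inv \<sigma> j"])
    show "(inv \<sigma> j, j) \<in> (\<lambda>i. (i, \<sigma> i)) ` {1..k}"
      using permutes_in_image[OF permutes_inv[OF assms(1)]] that
      by (intro image_eqI[of _ _ "inv \<sigma> j"]) (simp_all only: permutes_inverses[OF assms(1)])
    show "i = inv \<sigma> j" if "(i, j) \<in> (\<lambda>i. (i, \<sigma> i)) ` {1..k}" for i
      using that permutes_inverses[OF assms(1)] by auto
  qed
  moreover have "\<exists>!j. (i, j) \<in> (\<lambda>i. (i, \<sigma> i)) ` {1..k}" if "i \<in> {1..k}" for i
    using that by (intro ex1I[of _ "\<sigma> i"]) auto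
  moreover have "(\<lambda>i. (i, \<sigma> i)) ` {1..k} \<subseteq> {1..k} \<times> {1..k}"
    using permutes_in_image[OF assms(1)] by fastforce
  moreover have "(\<lambda>i. (i, \<sigma> i)) ` I \<subseteq> (\<lambda>i. (i, \<sigma> i)) ` {1..k}"
    using assms by blast
  ultimately show ?thesis by (simp only: superdiagrams_def diag_def superdiagram.simps mem_Collect_eq) blast
qed

text \<open>Unique bottom vertices make the edge set the graph of a function, and unique top
  vertices make it injective; on a finite set this is a permutation.\<close>

lemma superdiagramE:
  assumes "d \<in> superdiagrams k"
  obtains \<sigma> I where "\<sigma> permutes {1..k}" "I \<subseteq> {1..k}" "d = diag k \<sigma> I"
proof
  let ?\<sigma> = "diagram_perm k d"
  have sub: "edges d \<subseteq> {1..k} \<times> {1..k}" "marked d \<subseteq> edges d"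
    and ex1: "\<And>i. i \<in> {1..k} \<Longrightarrow> \<exists>!j. (i, j) \<in> edges d"
    and ex2: "\<And>j. j \<in> {1..k} \<Longrightarrow> \<exists>!i. (i, j) \<in> edges d"
    using assms by (auto simp: superdiagrams_def)
  have edge: "(i, j) \<in> edges d \<longleftrightarrow> i \<in> {1..k} \<and> j = ?\<sigma> i" for i j
  proof (cases "i \<in> {1..k}")
    case True
    then show ?thesis using theI'[OF ex1[OF True]] ex1[OF True] by (auto simp: diagram_perm_def)
  qed (use sub in auto)
  show "?\<sigma> permutes {1..k}"
  proof (rule bij_imp_permutes)
    have "inj_on ?\<sigma> {1..k}"
      using ex2 sub edge by (intro inj_onI) (metis mem_Sigma_iff subsetD)
    moreover have "?\<sigma> ` {1..k} \<subseteq> {1..k}" using sub edge by blast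
    ultimately show "bij_betw ?\<sigma> {1..k} {1..k}"
      by (simp add: bij_betw_def endo_inj_surj)
  qed (auto simp: diagram_perm_def)
  show "fst ` marked d \<subseteq> {1..k}" using sub by auto
  have "edges d = (\<lambda>i. (i, ?\<sigma> i)) ` {1..k}" using edge by auto
  moreover have "marked d = (\<lambda>i. (i, ?\<sigma> i)) ` fst ` marked d"
    using sub(2) edge by (force simp: image_iff)
  ultimately show "d = diag k ?\<sigma> (fst ` marked d)" by (simp add: diag_def)
qed

section \<open>Reading off and multiplying diagrams in coordinates\<close>

lemma marked_tops_diag: "marked_tops (diag k \<sigma> I) = slist I"
  by (simp add: marked_tops_def diag_def image_image)

lemma card_marked_diag: "card (marked (diag k \<sigma> I)) = card I"
  by (auto simp: diag_def inj_on_def intro: card_image)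

lemma diagram_perm_diag: "\<sigma> permutes {1..k} \<Longrightarrow> diagram_perm k (diag k \<sigma> I) = \<sigma>"
  by (auto simp: diagram_perm_def diag_def fun_eq_iff permutes_not_in image_iff)

lemma fst_marked_diag: "fst ` marked (diag k \<sigma> I) = I"
  by (simp add: diag_def image_image)

lemma diag_eq_iff:
  assumes "\<sigma> permutes {1..k}" "\<tau> permutes {1..k}"
  shows "diag k \<sigma> I = diag k \<tau> J \<longleftrightarrow> \<sigma> = \<tau> \<and> I = J"
  by (metis diagram_perm_diag assms fst_marked_diag)

text \<open>The marks of the lower diagram are indexed by middle vertices, and
  \<open>inv \<tau>\<close> carries them to the top row. The parity rule for marks then becomes a
  symmetric difference.\<close>

lemma dstar_diag:
  assumes "\<sigma> permutes {1..k}" "\<tau> permutes {1..k}" "I \<subseteq> {1..k}" "J \<subseteq> {1..k}"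
  shows "dstar (diag k \<sigma> I) (diag k \<tau> J) = diag k (\<sigma> \<circ> \<tau>) (sym_diff (inv \<tau> ` I) J)"
proof -
  define A where "A = {1..k}"
  have \<tau>: "\<tau> x \<in> A \<longleftrightarrow> x \<in> A" "x \<in> inv \<tau> ` I \<longleftrightarrow> \<tau> x \<in> I" for x
    using permutes_in_image[OF assms(2)] permutes_inverses[OF assms(2)]
    unfolding A_def by (blast, metis image_iff)
  have I: "\<tau> x \<in> I \<Longrightarrow> x \<in> A" and J: "x \<in> J \<Longrightarrow> x \<in> A" for x
    using \<tau>(1) assms(3,4) unfolding A_def by blast+
  have e: "(x, y) \<in> edges (diag k \<rho> K) \<longleftrightarrow> x \<in> A \<and> y = \<rho> x" for x y \<rho> K
    unfolding diag_def A_def by auto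
  have m: "(x, y) \<in> marked (diag k \<rho> K) \<longleftrightarrow> x \<in> K \<and> y = \<rho> x" for x y \<rho> K
    unfolding diag_def by auto
  have "{(x, z). \<exists>y. (x, y) \<in> edges (diag k \<tau> J) \<and> (y, z) \<in> edges (diag k \<sigma> I)}
      = edges (diag k (\<sigma> \<circ> \<tau>) (sym_diff (inv \<tau> ` I) J))" (is "?L = ?R")
  proof -
    have "(x, z) \<in> ?R \<longleftrightarrow> x \<in> A \<and> z = \<sigma> (\<tau> x)" for x z by (simp add: e)
    moreover have "(x, z) \<in> ?L \<longleftrightarrow> x \<in> A \<and> z = \<sigma> (\<tau> x)" for x z
      by (simp add: e \<tau>(1))
    ultimately show ?thesis by (intro equalityI subrelI) simp_all
  qed
  moreover have "{(x, z). \<exists>y. (x, y) \<in> edges (diag k \<tau> J) \<and> (y, z) \<in> edges (diag k \<sigma> I) \<and>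
        odd (of_bool ((x, y) \<in> marked (diag k \<tau> J)) + of_bool ((y, z) \<in> marked (diag k \<sigma> I)) :: nat)}
      = marked (diag k (\<sigma> \<circ> \<tau>) (sym_diff (inv \<tau> ` I) J))" (is "?L = ?R")
  proof -
    have "(x, z) \<in> ?L \<longleftrightarrow> x \<in> A \<and> z = \<sigma> (\<tau> x) \<and> (x \<in> J \<longleftrightarrow> \<tau> x \<notin> I)" for x z
      using \<tau>(1)[of x] J[of x] by (simp add: e m) blast
    moreover have "(x, z) \<in> ?R \<longleftrightarrow> x \<in> A \<and> z = \<sigma> (\<tau> x) \<and> (x \<in> J \<longleftrightarrow> \<tau> x \<notin> I)" for x z
    proof -
      have "(x, z) \<in> ?R \<longleftrightarrow> x \<in> sym_diff (inv \<tau> ` I) J \<and> z = \<sigma> (\<tau> x)"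
        by (simp add: m)
      then show ?thesis using \<tau>(2)[of x] I J by blast
    qed
    ultimately show ?thesis by (intro equalityI subrelI) simp_all
  qed
  ultimately show ?thesis by (simp add: dstar_def)
qed

lemma rho_diag:
  assumes "\<tau> permutes {1..k}"
  shows "rho (diag k \<sigma> I) (diag k \<tau> J) = card (inv \<tau> ` I \<inter> J)"
proof -
  have "x \<in> inv \<tau> ` I \<longleftrightarrow> \<tau> x \<in> I" for x
    using permutes_inverses[OF assms] by (auto simp: image_iff) metis
  then have "{(x, z). \<exists>y. (x, y) \<in> marked (diag k \<tau> J) \<and> (y, z) \<in> marked (diag k \<sigma> I)}
      = (\<lambda>x. (x, \<sigma> (\<tau> x))) ` (inv \<tau> ` I \<inter> J)"
    by (auto simp: diag_def)
  then show ?thesis by (simp add: rho_def card_image inj_on_def)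
qed

lemma ell_diag:
  assumes "\<tau> permutes {1..k}" "I \<subseteq> {1..k}"
  shows "ell (diag k \<sigma> I) (diag k \<tau> J) = arranging_number (map (inv \<tau>) (slist I) @ slist J)"
proof -
  have "(THE x. (x, y) \<in> edges (diag k \<tau> J)) = inv \<tau> y" if "y \<in> {1..k}" for y
    using that permutes_inverses[OF assms(1)] permutes_in_image[OF permutes_inv[OF assms(1)], of y]
    by (intro the_equality) (auto simp: diag_def image_iff)
  moreover have "finite I" using assms finite_subset by blast
  ultimately have "map (\<lambda>y. THE x. (x, y) \<in> edges (diag k \<tau> J)) (slist I) = map (inv \<tau>) (slist I)"
    using assms by (intro map_cong) auto
  then show ?thesis by (simp only: ell_def marked_tops_diag)
qed

section \<open>Multiplicativity on basis diagrams\<close>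

lemma phi_basis_diag:
  assumes "set js \<subseteq> {1..<k}" "I \<subseteq> {1..k}"
  shows "phi_basis k (diag k (transposition_prod js) I) = mon k 1 (map gS js @ map gC (slist I))"
proof -
  have "finite I" using assms finite_subset by blast
  then show ?thesis
    using assms transposition_prod_permutes[OF assms(1)]
    by (simp add: phi_basis_def diagram_perm_diag ser_perm_eq marked_tops_diag ser_monomial_eq_mon mon_mult)
qed

text \<open>A choice is made because a permutation has many words. The class does not depend on it,
  but a fixed word for each diagram is what lets \<open>phi\<close> be lifted to the free
  algebra.\<close>

definition diagram_word :: "nat \<Rightarrow> superdiagram \<Rightarrow> gen list"
  where "diagram_word k d =
    map gS (SOME js. set js \<subseteq> {1..<k} \<and> transposition_prod js = diagram_perm k d)
      @ map gC (marked_tops d)"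

lemma superdiagram_wordE:
  assumes "d \<in> superdiagrams k"
  obtains js I where "set js \<subseteq> {1..<k}" "I \<subseteq> {1..k}" "finite I" "d = diag k (transposition_prod js) I"
    "diagram_word k d = map gS js @ map gC (slist I)"
proof -
  obtain \<sigma> I where d: "\<sigma> permutes {1..k}" "I \<subseteq> {1..k}" "d = diag k \<sigma> I"
    by (rule superdiagramE[OF assms])
  define js where "js = (SOME js. set js \<subseteq> {1..<k} \<and> transposition_prod js = \<sigma>)"
  have "\<exists>js. set js \<subseteq> {1..<k} \<and> transposition_prod js = \<sigma>"
    by (metis permutes_transposition_prod[OF d(1)])
  then have "set js \<subseteq> {1..<k} \<and> transposition_prod js = \<sigma>"
    unfolding js_def by (rule someI_ex)
  moreover have "diagram_word k d = map gS js @ map gC (slist I)"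
    unfolding diagram_word_def js_def d(3) diagram_perm_diag[OF d(1)] marked_tops_diag ..
  ultimately show thesis using d finite_subset[OF d(2)] by (intro that) auto
qed

lemma diagram_word_gens: "d \<in> superdiagrams k \<Longrightarrow> set (diagram_word k d) \<subseteq> gens k"
  by (erule superdiagram_wordE) simp

lemma phi_basis_eq_mon: "d \<in> superdiagrams k \<Longrightarrow> phi_basis k d = mon k 1 (diagram_word k d)"
  by (erule superdiagram_wordE) (simp add: phi_basis_diag)

lemma dstar_closed:
  assumes "d1 \<in> superdiagrams k" "d2 \<in> superdiagrams k"
  shows "dstar d1 d2 \<in> superdiagrams k"
proof -
  obtain \<sigma> I where 1: "\<sigma> permutes {1..k}" "I \<subseteq> {1..k}" "d1 = diag k \<sigma> I"
    by (rule superdiagramE[OF assms(1)])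
  obtain \<tau> J where 2: "\<tau> permutes {1..k}" "J \<subseteq> {1..k}" "d2 = diag k \<tau> J"
    by (rule superdiagramE[OF assms(2)])
  have "inv \<tau> ` I \<subseteq> {1..k}"
    using 1 permutes_in_image[OF permutes_inv[OF 2(1)]] by auto
  then show ?thesis
    unfolding 1 2 dstar_diag[OF 1(1) 2(1) 1(2) 2(2)]
    using 1 2 by (intro diag_in_superdiagrams permutes_compose) auto
qed

text \<open>The first Clifford block crosses the second permutation, becoming the sequence a_1 ...
  a_p of \<open>ell\<close>, and is sorted into the second block: repeated letters are counted by
  \<open>rho\<close>, inversions by \<open>ell\<close>.\<close>

lemma phi_basis_dstar:
  assumes "d1 \<in> superdiagrams k" "d2 \<in> superdiagrams k"
  shows "mon k 1 (diagram_word k d1 @ diagram_word k d2)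
    = mon k ((- 1) ^ (rho d1 d2 + ell d1 d2)) (diagram_word k (dstar d1 d2))"
proof -
  obtain u I where 1: "set u \<subseteq> {1..<k}" "I \<subseteq> {1..k}" "finite I" "d1 = diag k (transposition_prod u) I"
    "diagram_word k d1 = map gS u @ map gC (slist I)"
    by (rule superdiagram_wordE[OF assms(1)])
  obtain v J where 2: "set v \<subseteq> {1..<k}" "J \<subseteq> {1..k}" "finite J" "d2 = diag k (transposition_prod v) J"
    "diagram_word k d2 = map gS v @ map gC (slist J)"
    by (rule superdiagram_wordE[OF assms(2)])
  let ?i = "inv (transposition_prod v)"
  let ?K = "sym_diff (?i ` I) J"
  let ?s = "(- 1) ^ (rho d1 d2 + ell d1 d2) :: complex"
  note p = transposition_prod_permutes[OF 1(1)] transposition_prod_permutes[OF 2(1)]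
  have iI: "?i ` I \<subseteq> {1..k}"
    using 1(2) permutes_in_image[OF permutes_inv[OF p(2)]] by auto
  then have K: "?K \<subseteq> {1..k}" "finite ?K" using 1 2 by auto
  \<comment> \<open>Crossing a permutation keeps the letters distinct, as
    \<open>mon_Cs_sorted\<close> requires.\<close>
  have "inj_on ?i I" using permutes_inj[OF permutes_inv[OF p(2)]] by (rule inj_on_subset) simp
  then have dist: "distinct (map ?i (slist I))" using 1 by (simp add: distinct_map)
  have star: "dstar d1 d2 = diag k (transposition_prod (u @ v)) ?K"
    unfolding 1(4) 2(4) using dstar_diag[OF p 1(2) 2(2)] by simp
  have "mon k 1 (diagram_word k d1 @ diagram_word k d2)
      = mon k 1 (map gS u @ (map gC (slist I) @ map gS v) @ map gC (slist J))"
    by (simp add: 1(5) 2(5))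
  also have "\<dots> = mon k 1 (map gS u @ (map gS v @ map gC (map ?i (slist I))) @ map gC (slist J))"
    using mon_context[OF mon_Cs_perm[OF 2(1), of "slist I"], of "map gS u" "map gC (slist J)" 1] 1 2 iI
    by (simp del: map_map append_assoc)
  also have "\<dots> = mon k 1 ((map gS u @ map gS v) @ (map gC (map ?i (slist I)) @ map gC (slist J)))"
    by simp
  also have "\<dots> = mon k ?s ((map gS u @ map gS v) @ map gC (slist ?K))"
    using mon_context[OF mon_Cs_sorted[OF dist _ 2(2)], of "map gS u @ map gS v" "[]" 1] 1 2 iI K
      rho_diag[OF p(2), of "transposition_prod u" I J] ell_diag[OF p(2) 1(2), of "transposition_prod u" J]
    by (simp del: map_map append_assoc)
  also have "\<dots> = mon k ?s (diagram_word k (dstar d1 d2))"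
  proof -
    have "dstar d1 d2 \<in> superdiagrams k" by (rule dstar_closed[OF assms])
    \<comment> \<open>The permutation word chosen for the product may differ from
      \<open>u @ v\<close>; the classes agree because both represent the same
      \<open>phi_basis\<close> element.\<close>
    then have "mon k 1 (diagram_word k (dstar d1 d2)) = mon k 1 (map gS (u @ v) @ map gC (slist ?K))"
      using phi_basis_eq_mon phi_basis_diag[of "u @ v" k ?K] star 1 2 K by simp
    then show ?thesis
      using mon_context[of k 1 "diagram_word k (dstar d1 d2)" 1 "map gS (u @ v) @ map gC (slist ?K)" "[]" "[]" ?s]
        diagram_word_gens[OF dstar_closed[OF assms]] 1 2 K by simp
  qed
  finally show ?thesis .
qed

section \<open>The isomorphism\<close>

lemma Dvec_simps [simp]:
  "one (Dvec k) = Poly_Mapping.single (diag k id {}) 1"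
  "zero (Dvec k) = 0" "add (Dvec k) = (+)" "module.smult (Dvec k) = smul"
proof -
  have "Id_on {1..k} = (\<lambda>i. (i, i)) ` {1..k}" by auto
  then show "one (Dvec k) = Poly_Mapping.single (diag k id {}) 1"
    by (simp add: Dvec_def diag_def)
qed (simp_all add: Dvec_def)

lemma carrier_Dvec: "p \<in> carrier (Dvec k) \<longleftrightarrow> Poly_Mapping.keys p \<subseteq> superdiagrams k"
  by (simp add: Dvec_def)

lemma hgs_Dvec: "p \<in> hgs (Dvec k) i \<longleftrightarrow>
    Poly_Mapping.keys p \<subseteq> {d \<in> superdiagrams k. of_nat (card (marked d)) = i}"
  by (simp add: Dvec_def)

lemma mult_Dvec: "p \<otimes>\<^bsub>Dvec k\<^esub> q =
    (\<Sum>d1\<in>Poly_Mapping.keys p. \<Sum>d2\<in>Poly_Mapping.keys q. Poly_Mapping.single (dstar d1 d2)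
      (Poly_Mapping.lookup p d1 * Poly_Mapping.lookup q d2 * (- 1) ^ (rho d1 d2 + ell d1 d2)))"
  by (simp add: Dvec_def)

lemma carrier_Dvec_closed [simp, intro]:
  "0 \<in> carrier (Dvec k)"
  "d \<in> superdiagrams k \<Longrightarrow> Poly_Mapping.single d c \<in> carrier (Dvec k)"
  "p \<in> carrier (Dvec k) \<Longrightarrow> - p \<in> carrier (Dvec k)"
  "p \<in> carrier (Dvec k) \<Longrightarrow> smul c p \<in> carrier (Dvec k)"
  "\<lbrakk>p \<in> carrier (Dvec k); q \<in> carrier (Dvec k)\<rbrakk> \<Longrightarrow> p + q \<in> carrier (Dvec k)"
  "\<lbrakk>p \<in> carrier (Dvec k); q \<in> carrier (Dvec k)\<rbrakk> \<Longrightarrow> p - q \<in> carrier (Dvec k)"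
  unfolding carrier_Dvec
  by (simp_all add: keys_plus_subset keys_minus_subset order.trans[OF keys_smul])

lemma mult_Dvec_closed:
  assumes "p \<in> carrier (Dvec k)" "q \<in> carrier (Dvec k)"
  shows "p \<otimes>\<^bsub>Dvec k\<^esub> q \<in> carrier (Dvec k)"
  using assms unfolding mult_Dvec carrier_Dvec
  by (intro keys_sum_subset) (auto intro!: dstar_closed)

lemma id_diag_in_superdiagrams: "diag k id {} \<in> superdiagrams k"
  by (rule diag_in_superdiagrams) (auto intro: permutes_id)

text \<open>A linear lift of \<open>phi\<close> through \<open>cls\<close>. It replaces the finite
  sum in \<open>Ser\<close> by a sum of polynomials, to which additivity and \<open>poly_act\<close>
  apply directly.\<close>

definition phi_lift :: "nat \<Rightarrow> (superdiagram \<Rightarrow>\<^sub>0 complex) \<Rightarrow> gen list \<Rightarrow>\<^sub>0 complex"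
  where "phi_lift k p =
    (\<Sum>d\<in>Poly_Mapping.keys p. Poly_Mapping.single (diagram_word k d) (Poly_Mapping.lookup p d))"

lemma phi_lift_superset:
  assumes "finite A" "Poly_Mapping.keys p \<subseteq> A"
  shows "phi_lift k p = (\<Sum>d\<in>A. Poly_Mapping.single (diagram_word k d) (Poly_Mapping.lookup p d))"
  unfolding phi_lift_def using assms by (intro sum.mono_neutral_left) (auto simp: in_keys_iff)

lemma phi_lift_0 [simp]: "phi_lift k 0 = 0"
  by (simp add: phi_lift_def)

lemma phi_lift_single: "phi_lift k (Poly_Mapping.single d a) = Poly_Mapping.single (diagram_word k d) a"
  by (subst phi_lift_superset[of "{d}"]) auto

lemma phi_lift_add: "phi_lift k (p + q) = phi_lift k p + phi_lift k q"
proof -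
  let ?A = "Poly_Mapping.keys p \<union> Poly_Mapping.keys q"
  have "phi_lift k r = (\<Sum>d\<in>?A. Poly_Mapping.single (diagram_word k d) (Poly_Mapping.lookup r d))"
    if "r = p \<or> r = q \<or> r = p + q" for r
    using that keys_add[of p q] by (intro phi_lift_superset) auto
  then show ?thesis by (simp add: lookup_add single_add sum.distrib)
qed

lemma phi_lift_sum: "phi_lift k (sum f A) = (\<Sum>x\<in>A. phi_lift k (f x))"
  by (induction A rule: infinite_finite_induct) (auto simp: phi_lift_add)

lemma smul_single: "smul c (Poly_Mapping.single x a) = Poly_Mapping.single x (c * a)"
  by (simp add: map_single)

lemma phi_lift_smul: "phi_lift k (smul c p) = smul c (phi_lift k p)"
  unfolding phi_lift_superset[OF finite_keys keys_smul] phi_lift_def[of k p]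
  by (simp add: smul_sum smul_single)

lemma phi_lift_carrier: "p \<in> carrier (Dvec k) \<Longrightarrow> phi_lift k p \<in> carrier (free_superalg k)"
  unfolding phi_lift_def carrier_Dvec
  by (intro carrier_free_closed(3,9) diagram_word_gens) auto

lemma phi_eq_cls: "p \<in> carrier (Dvec k) \<Longrightarrow> phi k p = cls k (phi_lift k p)"
proof -
  interpret ring "Ser k" by (rule ring_Ser)
  assume "p \<in> carrier (Dvec k)"
  then have sub: "Poly_Mapping.keys p \<subseteq> superdiagrams k" by (simp add: carrier_Dvec)
  let ?f = "\<lambda>d. Poly_Mapping.single (diagram_word k d) (Poly_Mapping.lookup p d)"
  have f: "?f d \<in> carrier (free_superalg k)" if "d \<in> Poly_Mapping.keys p" for d
    using that sub diagram_word_gens by auto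
  have "phi k p = (\<Oplus>\<^bsub>Ser k\<^esub>d\<in>Poly_Mapping.keys p. cls k (?f d))"
    unfolding phi_def
  proof (rule finsum_cong')
    fix d assume "d \<in> Poly_Mapping.keys p"
    then have "d \<in> superdiagrams k" using sub by blast
    then show "Poly_Mapping.lookup p d \<odot>\<^bsub>Ser k\<^esub> phi_basis k d = cls k (?f d)"
      using diagram_word_gens[of d k] by (simp add: phi_basis_eq_mon mon_def Ser_ops smul_single)
  qed (use f in \<open>auto simp: Ser_simps\<close>)
  then show ?thesis using f by (simp add: Ser_finsum phi_lift_def)
qed

lemma cls_sum_cong:
  assumes "\<And>x. x \<in> A \<Longrightarrow> f x \<in> carrier (free_superalg k)"
    and "\<And>x. x \<in> A \<Longrightarrow> g x \<in> carrier (free_superalg k)"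
    and "\<And>x. x \<in> A \<Longrightarrow> cls k (f x) = cls k (g x)"
  shows "cls k (sum f A) = cls k (sum g A)"
  using assms
proof (induction A rule: infinite_finite_induct)
  case (insert a A)
  have "cls k (sum h (insert a A)) = cls k (h a) \<oplus>\<^bsub>Ser k\<^esub> cls k (sum h A)"
    if "h = f \<or> h = g" for h
    using that insert by (subst Ser_ops(2)) (auto intro!: carrier_free_closed(9))
  then show ?case using insert by simp
qed auto

text \<open>The lift itself need not be multiplicative, since the word chosen for a product may
  differ from the concatenated words. The two double sums are therefore compared term by term after
  passing to classes.\<close>

lemma phi_mult:
  assumes "p \<in> carrier (Dvec k)" "q \<in> carrier (Dvec k)"
  shows "phi k (p \<otimes>\<^bsub>Dvec k\<^esub> q) = phi k p \<otimes>\<^bsub>Ser k\<^esub> phi k q"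
proof -
  let ?a = "\<lambda>d1 d2. Poly_Mapping.lookup p d1 * Poly_Mapping.lookup q d2"
  let ?w = "diagram_word k"
  have sub: "d \<in> superdiagrams k" if "d \<in> Poly_Mapping.keys p \<or> d \<in> Poly_Mapping.keys q" for d
    using that assms by (auto simp: carrier_Dvec)
  have c: "Poly_Mapping.single (?w d1 @ ?w d2) a \<in> carrier (free_superalg k)"
    "Poly_Mapping.single (?w (dstar d1 d2)) a \<in> carrier (free_superalg k)"
    if "d1 \<in> Poly_Mapping.keys p" "d2 \<in> Poly_Mapping.keys q" for d1 d2 a
    using that sub diagram_word_gens dstar_closed by (auto intro!: carrier_free_closed(3))
  have "phi k (p \<otimes>\<^bsub>Dvec k\<^esub> q) = cls k (\<Sum>d1\<in>Poly_Mapping.keys p. \<Sum>d2\<in>Poly_Mapping.keys q.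
      Poly_Mapping.single (?w (dstar d1 d2)) (?a d1 d2 * (- 1) ^ (rho d1 d2 + ell d1 d2)))"
    using assms by (simp add: phi_eq_cls mult_Dvec_closed) (simp add: mult_Dvec phi_lift_sum phi_lift_single)
  also have "\<dots> = cls k (\<Sum>d1\<in>Poly_Mapping.keys p. \<Sum>d2\<in>Poly_Mapping.keys q.
      Poly_Mapping.single (?w d1 @ ?w d2) (?a d1 d2))"
  proof (intro cls_sum_cong carrier_free_closed(9) c)
    fix d1 d2 assume d: "d1 \<in> Poly_Mapping.keys p" "d2 \<in> Poly_Mapping.keys q"
    show "cls k (Poly_Mapping.single (?w (dstar d1 d2)) (?a d1 d2 * (- 1) ^ (rho d1 d2 + ell d1 d2)))
      = cls k (Poly_Mapping.single (?w d1 @ ?w d2) (?a d1 d2))"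
      using mon_context[OF phi_basis_dstar, of d1 k d2 "[]" "[]" "?a d1 d2"] d sub
        diagram_word_gens dstar_closed by (simp add: mon_def)
  qed
  also have "(\<Sum>d1\<in>Poly_Mapping.keys p. \<Sum>d2\<in>Poly_Mapping.keys q.
      Poly_Mapping.single (?w d1 @ ?w d2) (?a d1 d2)) = phi_lift k p * phi_lift k q"
    unfolding single_append phi_lift_def by (simp flip: sum_distrib_left sum_distrib_right)
  also have "cls k \<dots> = phi k p \<otimes>\<^bsub>Ser k\<^esub> phi k q"
    using assms by (simp add: phi_eq_cls Ser_ops phi_lift_carrier)
  finally show ?thesis .
qed

lemma phi_linear:
  assumes "p \<in> carrier (Dvec k)"
  shows "q \<in> carrier (Dvec k) \<Longrightarrow> phi k (p + q) = phi k p \<oplus>\<^bsub>Ser k\<^esub> phi k q"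
    and "phi k (smul c p) = c \<odot>\<^bsub>Ser k\<^esub> phi k p"
  using assms by (simp_all add: phi_eq_cls Ser_ops phi_lift_carrier phi_lift_add phi_lift_smul)

text \<open>Removes the arbitrary choice in \<open>diagram_word\<close>: any word for the
  permutation may be used. This evaluates \<open>phi\<close> on the unit and on the diagrams of the
  generators.\<close>

lemma phi_single_diag:
  assumes "set js \<subseteq> {1..<k}" "I \<subseteq> {1..k}"
  shows "phi k (Poly_Mapping.single (diag k (transposition_prod js) I) a)
    = cls k (Poly_Mapping.single (map gS js @ map gC (slist I)) a)"
proof -
  let ?d = "diag k (transposition_prod js) I"
  have d: "?d \<in> superdiagrams k"
    using assms by (intro diag_in_superdiagrams transposition_prod_permutes)
  have "finite I" using assms(2) finite_subset by blast
  then have "mon k (a * 1) ([] @ diagram_word k ?d @ []) = mon k (a * 1) ([] @ (map gS js @ map gC (slist I)) @ [])"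
    using phi_basis_eq_mon[OF d] phi_basis_diag[OF assms] diagram_word_gens[OF d] assms
    by (intro mon_context) auto
  then show ?thesis using d by (simp add: phi_eq_cls phi_lift_single mon_def)
qed

lemma phi_one: "phi k \<one>\<^bsub>Dvec k\<^esub> = \<one>\<^bsub>Ser k\<^esub>"
  using phi_single_diag[of "[]" k "{}" 1] by (simp add: Ser_simps one_eq_single)

lemma phi_eq_zeroD:
  assumes "p \<in> carrier (Dvec k)" "phi k p = cls k 0"
  shows "p = 0"
proof (rule poly_mapping_eqI)
  fix d
  show "Poly_Mapping.lookup p d = Poly_Mapping.lookup 0 d"
  proof (cases "d \<in> Poly_Mapping.keys p")
    case True
    have sub: "d \<in> superdiagrams k" if "d \<in> Poly_Mapping.keys p" for d
      using assms that by (auto simp: carrier_Dvec)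
    \<comment> \<open>The indicator function of the coordinate of \<open>d\<close>, which will read
      off the coefficient of \<open>d\<close>. The permutation is inverted because
      \<open>(\<tau>, I)\<close> stands for the basis element with
      \<open>inv \<tau>\<close>.\<close>
    define f :: vec where "f = (\<lambda>\<tau> I. of_bool (\<tau> = inv (diagram_perm k d) \<and> I = fst ` marked d))"
    obtain js I where d: "set js \<subseteq> {1..<k}" "I \<subseteq> {1..k}" "d = diag k (transposition_prod js) I"
      by (rule superdiagram_wordE[OF sub[OF True]])
    have f: "f = (\<lambda>\<tau> J. of_bool (\<tau> = inv (transposition_prod js) \<and> J = I))"
      unfolding f_def d(3) diagram_perm_diag[OF transposition_prod_permutes[OF d(1)]] fst_marked_diag ..
    have "inj_supported f"
      by (auto simp: inj_supported_def f bij_transposition_prod bij_is_inj bij_imp_bij_inv)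
    moreover have "phi_lift k p \<in> rep_kernel k"
      using assms sergeev_ideal_rep_kernel[of k] cls_eq_iff[of "phi_lift k p" k 0] phi_lift_carrier[OF assms(1)]
      by (auto simp: phi_eq_cls)
    ultimately have "0 = poly_act (phi_lift k p) f id {}"
      by (simp add: rep_kernel_def)
    also have "\<dots> = (\<Sum>e\<in>Poly_Mapping.keys p. Poly_Mapping.lookup p e * fold act (diagram_word k e) f id {})"
      by (simp add: phi_lift_def)
    also have "\<dots> = (\<Sum>e\<in>Poly_Mapping.keys p. Poly_Mapping.lookup p e * of_bool (e = d))"
    proof (rule sum.cong[OF refl])
      fix e assume "e \<in> Poly_Mapping.keys p"
      then obtain us J where e: "set us \<subseteq> {1..<k}" "finite J" "e = diag k (transposition_prod us) J"
        "diagram_word k e = map gS us @ map gC (slist J)"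
        using sub superdiagram_wordE by metis
      have "inv (transposition_prod us) = inv (transposition_prod js) \<longleftrightarrow> transposition_prod us = transposition_prod js"
        using inv_inv_eq bij_transposition_prod by metis
      moreover have "e = d \<longleftrightarrow> transposition_prod us = transposition_prod js \<and> J = I"
        unfolding e(3) d(3)
        by (rule diag_eq_iff[OF transposition_prod_permutes[OF e(1)] transposition_prod_permutes[OF d(1)]])
      ultimately show "Poly_Mapping.lookup p e * fold act (diagram_word k e) f id {}
          = Poly_Mapping.lookup p e * of_bool (e = d)"
        unfolding e(4) fold_act_SC[OF e(2)] f by simp
    qed
    also have "\<dots> = (\<Sum>e\<in>Poly_Mapping.keys p. if e = d then Poly_Mapping.lookup p e else 0)"
      by (intro sum.cong) auto
    also have "\<dots> = Poly_Mapping.lookup p d"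
      using True by (simp add: sum.delta)
    finally show ?thesis by simp
  qed (simp add: in_keys_iff)
qed

lemma inj_on_phi: "inj_on (phi k) (carrier (Dvec k))"
proof (rule inj_onI)
  fix p q assume *: "p \<in> carrier (Dvec k)" "q \<in> carrier (Dvec k)" "phi k p = phi k q"
  then have "phi_lift k (p - q) = phi_lift k p - phi_lift k q"
    using phi_lift_add[of k "p - q" q] by simp
  then have "phi k (p - q) = cls k 0"
    using * by (simp add: phi_eq_cls cls_eq_iff phi_lift_carrier)
  then show "p = q" using phi_eq_zeroD[of "p - q" k] * by simp
qed

section \<open>Gradings\<close>

lemma of_nat_bit_eq_iff: "(of_nat m :: bit) = of_nat n \<longleftrightarrow> (even m \<longleftrightarrow> even n)"
proof -
  have "(of_nat n :: bit) = of_bool (odd n)" for n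
    by (induction n) auto
  then show ?thesis by auto
qed

lemma diagram_word_parity:
  assumes "d \<in> superdiagrams k"
  shows "length (filter is_C (diagram_word k d)) = card (marked d)"
proof -
  obtain js I where "finite I" "d = diag k (transposition_prod js) I"
    "diagram_word k d = map gS js @ map gC (slist I)"
    by (rule superdiagram_wordE[OF assms])
  then show ?thesis
    by (simp add: card_marked_diag is_C_def filter_map comp_def)
qed

lemma dstar_parity:
  assumes "d1 \<in> superdiagrams k" "d2 \<in> superdiagrams k"
  shows "(of_nat (card (marked (dstar d1 d2))) :: bit) = of_nat (card (marked d1)) + of_nat (card (marked d2))"
proof -
  obtain \<sigma> I where 1: "\<sigma> permutes {1..k}" "I \<subseteq> {1..k}" "d1 = diag k \<sigma> I"
    by (rule superdiagramE[OF assms(1)])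
  obtain \<tau> J where 2: "\<tau> permutes {1..k}" "J \<subseteq> {1..k}" "d2 = diag k \<tau> J"
    by (rule superdiagramE[OF assms(2)])
  have fin: "finite I" "finite J" using 1(2) 2(2) finite_subset by blast+
  have "card (inv \<tau> ` I) = card I"
    using permutes_inj[OF permutes_inv[OF 2(1)]] by (intro card_image) (rule inj_on_subset, auto)
  then show ?thesis
    unfolding of_nat_add[symmetric] of_nat_bit_eq_iff 1(3) 2(3) dstar_diag[OF 1(1) 2(1) 1(2) 2(2)] card_marked_diag
    using fin card_sym_diff_even[of "inv \<tau> ` I" J] by simp
qed

lemma hgs_Dvec_mult:
  assumes "p \<in> hgs (Dvec k) i" "q \<in> hgs (Dvec k) j"
  shows "p \<otimes>\<^bsub>Dvec k\<^esub> q \<in> hgs (Dvec k) (i + j)"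
  unfolding mult_Dvec hgs_Dvec
proof (intro keys_sum_subset)
  fix d1 d2 assume "d1 \<in> Poly_Mapping.keys p" "d2 \<in> Poly_Mapping.keys q"
  then have "d1 \<in> superdiagrams k" "of_nat (card (marked d1)) = i"
    "d2 \<in> superdiagrams k" "of_nat (card (marked d2)) = j"
    using assms by (auto simp only: hgs_Dvec)
  then have "dstar d1 d2 \<in> {d \<in> superdiagrams k. of_nat (card (marked d)) = i + j}"
    by (simp add: dstar_parity dstar_closed)
  then show "Poly_Mapping.keys (Poly_Mapping.single (dstar d1 d2) (Poly_Mapping.lookup p d1 *
      Poly_Mapping.lookup q d2 * (- 1) ^ (rho d1 d2 + ell d1 d2)))
      \<subseteq> {d \<in> superdiagrams k. of_nat (card (marked d)) = i + j}"
    by simp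
qed

lemma hgs_Dvec_closed:
  "hgs (Dvec k) i \<subseteq> carrier (Dvec k)" "0 \<in> hgs (Dvec k) i"
  "p \<in> hgs (Dvec k) i \<Longrightarrow> - p \<in> hgs (Dvec k) i"
  "p \<in> hgs (Dvec k) i \<Longrightarrow> smul c p \<in> hgs (Dvec k) i"
  "\<lbrakk>p \<in> hgs (Dvec k) i; q \<in> hgs (Dvec k) i\<rbrakk> \<Longrightarrow> p + q \<in> hgs (Dvec k) i"
proof -
  show "hgs (Dvec k) i \<subseteq> carrier (Dvec k)" unfolding hgs_Dvec carrier_Dvec subset_iff by blast
qed (simp_all only: hgs_Dvec keys_plus_subset keys_uminus keys_zero empty_subsetI order.trans[OF keys_smul])

lemma hgs_free_closed:
  "hgs (free_superalg k) i \<subseteq> carrier (free_superalg k)" "0 \<in> hgs (free_superalg k) i"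
  "p \<in> hgs (free_superalg k) i \<Longrightarrow> - p \<in> hgs (free_superalg k) i"
  "p \<in> hgs (free_superalg k) i \<Longrightarrow> smul c p \<in> hgs (free_superalg k) i"
  "\<lbrakk>p \<in> hgs (free_superalg k) i; q \<in> hgs (free_superalg k) i\<rbrakk> \<Longrightarrow> p + q \<in> hgs (free_superalg k) i"
  "\<lbrakk>p \<in> hgs (free_superalg k) i; q \<in> hgs (free_superalg k) j\<rbrakk> \<Longrightarrow> p * q \<in> hgs (free_superalg k) (i + j)"
proof -
  show "p * q \<in> hgs (free_superalg k) (i + j)"
    if "p \<in> hgs (free_superalg k) i" "q \<in> hgs (free_superalg k) j"
    using that unfolding hgs_free by (rule keys_times_lists) auto
  show "hgs (free_superalg k) i \<subseteq> carrier (free_superalg k)" unfolding hgs_free carrier_free subset_iff by blast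
qed (simp_all only: hgs_free keys_plus_subset keys_uminus keys_zero empty_subsetI order.trans[OF keys_smul])

section \<open>Splitting into homogeneous components\<close>

lemma poly_mapping_split:
  assumes "Poly_Mapping.keys (p :: 'a \<Rightarrow>\<^sub>0 complex) \<subseteq> A \<union> B"
  obtains q r where "p = q + r" "Poly_Mapping.keys q \<subseteq> A" "Poly_Mapping.keys r \<subseteq> B"
proof
  let ?s = "\<lambda>x. Poly_Mapping.single x (Poly_Mapping.lookup p x)"
  let ?K = "Poly_Mapping.keys p"
  have "p = sum ?s ?K" by (rule poly_mapping_sum_single[symmetric]) auto
  also have "\<dots> = sum ?s (?K \<inter> A) + sum ?s (?K - A)"
    by (rule sum.Int_Diff) simp
  finally show "p = sum ?s (?K \<inter> A) + sum ?s (?K - A)" .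
  show "Poly_Mapping.keys (sum ?s (?K \<inter> A)) \<subseteq> A" by (intro keys_sum_subset) auto
  show "Poly_Mapping.keys (sum ?s (?K - A)) \<subseteq> B" using assms by (intro keys_sum_subset) auto
qed

lemma hgs_Dvec_split:
  assumes "p \<in> carrier (Dvec k)"
  obtains q r where "p = q + r" "q \<in> hgs (Dvec k) 0" "r \<in> hgs (Dvec k) 1"
proof -
  let ?A = "\<lambda>i. {d \<in> superdiagrams k. (of_nat (card (marked d)) :: bit) = i}"
  have "superdiagrams k \<subseteq> ?A 0 \<union> ?A 1" by auto
  then have "Poly_Mapping.keys p \<subseteq> ?A 0 \<union> ?A 1" using assms by (auto simp: carrier_Dvec)
  then show thesis by (rule poly_mapping_split) (use that in \<open>auto simp: hgs_Dvec\<close>)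
qed

lemma hgs_free_split:
  assumes "p \<in> carrier (free_superalg k)"
  obtains q r where "p = q + r" "q \<in> hgs (free_superalg k) 0" "r \<in> hgs (free_superalg k) 1"
proof -
  let ?A = "\<lambda>i. {w \<in> lists (gens k). (of_nat (length (filter is_C w)) :: bit) = i}"
  have "lists (gens k) \<subseteq> ?A 0 \<union> ?A 1" by auto
  then have "Poly_Mapping.keys p \<subseteq> ?A 0 \<union> ?A 1" using assms by (auto simp: carrier_free)
  then show thesis by (rule poly_mapping_split) (use that in \<open>auto simp: hgs_free\<close>)
qed

lemma hgs_Dvec_disjoint: "hgs (Dvec k) 0 \<inter> hgs (Dvec k) 1 = {0}"
proof -
  have "p = 0" if "p \<in> hgs (Dvec k) 0" "p \<in> hgs (Dvec k) 1" for p
  proof -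
    have "x \<notin> Poly_Mapping.keys p" for x
      using that unfolding hgs_Dvec by (cases "x \<in> Poly_Mapping.keys p") (simp_all add: subset_iff)
    then have "Poly_Mapping.keys p = {}" by blast
    then show ?thesis by simp
  qed
  then show ?thesis using hgs_Dvec_closed(2) by blast
qed

lemma phi_hgs: "phi k ` hgs (Dvec k) i \<subseteq> hgs (Ser k) i"
proof (rule image_subsetI)
  fix p assume p: "p \<in> hgs (Dvec k) i"
  then have "phi_lift k p \<in> hgs (free_superalg k) i"
    unfolding phi_lift_def hgs_free
  proof (intro keys_sum_subset)
    fix d assume "d \<in> Poly_Mapping.keys p"
    then have d: "d \<in> superdiagrams k" "of_nat (card (marked d)) = i"
      using p unfolding hgs_Dvec by blast+
    then show "Poly_Mapping.keys (Poly_Mapping.single (diagram_word k d) (Poly_Mapping.lookup p d))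
        \<subseteq> {w \<in> lists (gens k). of_nat (length (filter is_C w)) = i}"
      using diagram_word_gens[OF d(1)] diagram_word_parity[OF d(1)] by (simp add: lists_eq_set)
  qed
  moreover have "phi k p = cls k (phi_lift k p)"
    using p hgs_Dvec_closed(1) by (intro phi_eq_cls) blast
  ultimately show "phi k p \<in> hgs (Ser k) i" by (simp add: Ser_simps)
qed

text \<open>Every generator is the image of a homogeneous diagram, with one adjacent transposition
  or one marked edge, and \<open>phi\<close> is multiplicative. Keeping track of the degree gives
  surjectivity on each graded part.\<close>

lemma word_in_phi_image:
  assumes "w \<in> lists (gens k)"
  shows "cls k (Poly_Mapping.single w a) \<in> phi k ` hgs (Dvec k) (of_nat (length (filter is_C w)))"
  using assms
proof (induction w)
  case Nil
  have "cls k (Poly_Mapping.single [] a) = phi k (Poly_Mapping.single (diag k id {}) a)"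
    using phi_single_diag[of "[]" k "{}" a] by simp
  moreover have "Poly_Mapping.single (diag k id {}) a \<in> hgs (Dvec k) 0"
    using id_diag_in_superdiagrams by (simp add: hgs_Dvec card_marked_diag)
  ultimately show ?case by simp
next
  case (Cons g w)
  obtain q where q: "q \<in> hgs (Dvec k) (of_bool (is_C g))" "phi k q = cls k (Poly_Mapping.single [g] 1)"
  proof (cases g)
    case (gS i)
    then have i: "i \<in> {1..<k}" using Cons.hyps by simp
    have "diag k (transposition_prod [i]) {} \<in> superdiagrams k"
      using i by (intro diag_in_superdiagrams transposition_prod_permutes) auto
    then have "Poly_Mapping.single (diag k (transposition_prod [i]) {}) 1 \<in> hgs (Dvec k) 0"
      by (simp add: hgs_Dvec card_marked_diag del: transposition_prod_Cons)
    then show thesis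
      using phi_single_diag[of "[i]" k "{}" 1] i gS
      by (intro that[of "Poly_Mapping.single (diag k (transposition_prod [i]) {}) 1"])
        (simp_all add: is_C_def del: transposition_prod_Cons)
  next
    case (gC i)
    then have i: "i \<in> {1..k}" using Cons.hyps by simp
    have "diag k id {i} \<in> superdiagrams k"
      using i by (intro diag_in_superdiagrams) (auto intro: permutes_id)
    then have "Poly_Mapping.single (diag k id {i}) 1 \<in> hgs (Dvec k) 1"
      by (simp add: hgs_Dvec card_marked_diag)
    then show thesis
      using phi_single_diag[of "[]" k "{i}" 1] i gC
      by (intro that[of "Poly_Mapping.single (diag k id {i}) 1"]) (simp_all add: is_C_def)
  qed
  obtain p where p: "p \<in> hgs (Dvec k) (of_nat (length (filter is_C w)))"
    "phi k p = cls k (Poly_Mapping.single w a)"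
    using Cons by (metis imageE)
  have "phi k (q \<otimes>\<^bsub>Dvec k\<^esub> p) = cls k (Poly_Mapping.single [g] 1 * Poly_Mapping.single w a)"
    using p q Cons.hyps hgs_Dvec_closed(1) by (simp add: phi_mult subsetD[OF hgs_Dvec_closed(1)] Ser_ops in_listsD subset_iff)
  also have "\<dots> = cls k (Poly_Mapping.single (g # w) a)" by (simp add: single_mult_words)
  finally have "cls k (Poly_Mapping.single (g # w) a) = phi k (q \<otimes>\<^bsub>Dvec k\<^esub> p)" ..
  moreover have "of_bool (is_C g) + of_nat (length (filter is_C w)) = (of_nat (length (filter is_C (g # w))) :: bit)"
    by simp
  then have "q \<otimes>\<^bsub>Dvec k\<^esub> p \<in> hgs (Dvec k) (of_nat (length (filter is_C (g # w))))"
    using hgs_Dvec_mult[OF q(1) p(1)] by simp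
  ultimately show ?case by blast
qed

lemma hgs_Ser_eq: "hgs (Ser k) i = phi k ` hgs (Dvec k) i"
proof
  show "hgs (Ser k) i \<subseteq> phi k ` hgs (Dvec k) i"
  proof
    fix x assume "x \<in> hgs (Ser k) i"
    then obtain p where p: "p \<in> hgs (free_superalg k) i" "x = cls k p" by (auto simp: Ser_simps)
    let ?s = "\<lambda>w. Poly_Mapping.single w (Poly_Mapping.lookup p w)"
    \<comment> \<open>Each monomial of \<open>p\<close> has degree \<open>i\<close>, so all partial
      sums stay in the image of one homogeneous part, which is closed under addition.\<close>
    have "cls k (sum ?s A) \<in> phi k ` hgs (Dvec k) i" if "finite A" "A \<subseteq> Poly_Mapping.keys p" for A
      using that
    proof (induction A rule: finite_induct)
      case empty
      have "cls k 0 = phi k 0" by (simp add: phi_eq_cls)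
      then show ?case using hgs_Dvec_closed(2) by auto
    next
      case (insert w A)
      have keys: "v \<in> lists (gens k)" "of_nat (length (filter is_C v)) = i" if "v \<in> Poly_Mapping.keys p" for v
        using that p(1) by (auto simp: hgs_free)
      obtain q r where *: "q \<in> hgs (Dvec k) i" "r \<in> hgs (Dvec k) i"
        "cls k (?s w) = phi k q" "cls k (sum ?s A) = phi k r"
        using insert word_in_phi_image[of w k "Poly_Mapping.lookup p w"] keys[of w] by blast
      have c: "?s v \<in> carrier (free_superalg k)" if "v \<in> Poly_Mapping.keys p" for v
        using keys[OF that] by (intro carrier_free_closed) auto
      then have "cls k (sum ?s (insert w A)) = cls k (?s w) \<oplus>\<^bsub>Ser k\<^esub> cls k (sum ?s A)"
        using insert by (subst Ser_ops(2)) (auto intro!: carrier_free_closed(9))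
      also have "\<dots> = phi k (q + r)"
        unfolding *(3,4) using * hgs_Dvec_closed(1) by (subst phi_linear(1)) blast+
      finally show ?case using * hgs_Dvec_closed(5) by blast
    qed
    from this[of "Poly_Mapping.keys p"] show "x \<in> phi k ` hgs (Dvec k) i"
      unfolding p(2) by (simp add: poly_mapping_sum_single)
  qed
qed (rule phi_hgs)

lemma phi_carrier: "p \<in> carrier (Dvec k) \<Longrightarrow> phi k p \<in> carrier (Ser k)"
  by (simp add: phi_eq_cls phi_lift_carrier Ser_simps)

lemma surj_phi: "phi k ` carrier (Dvec k) = carrier (Ser k)"
proof
  show "carrier (Ser k) \<subseteq> phi k ` carrier (Dvec k)"
  proof
    fix x assume "x \<in> carrier (Ser k)"
    then obtain p where p: "p \<in> carrier (free_superalg k)" "x = cls k p" by (auto simp: Ser_simps)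
    obtain q r where qr: "p = q + r" "q \<in> hgs (free_superalg k) 0" "r \<in> hgs (free_superalg k) 1"
      by (rule hgs_free_split[OF p(1)])
    then have "cls k q \<in> hgs (Ser k) 0" "cls k r \<in> hgs (Ser k) 1" by (auto simp: Ser_simps)
    then obtain q' r' where *: "q' \<in> carrier (Dvec k)" "r' \<in> carrier (Dvec k)"
      "cls k q = phi k q'" "cls k r = phi k r'"
      unfolding hgs_Ser_eq using hgs_Dvec_closed(1) by blast
    have "x = cls k q \<oplus>\<^bsub>Ser k\<^esub> cls k r"
      unfolding p(2) qr(1) using qr hgs_free_closed(1) by (subst Ser_ops(2)) blast+
    then have "x = phi k (q' + r')" using * by (simp add: phi_linear)
    then show "x \<in> phi k ` carrier (Dvec k)" using * by blast
  qed
qed (use phi_carrier in blast)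

section \<open>The superalgebra axioms\<close>

text \<open>Constants are central although words do not commute, because the empty word is neutral
  on both sides.\<close>

lemma mult_smul:
  fixes p q :: "'a list \<Rightarrow>\<^sub>0 complex"
  shows "p * smul c q = smul c (p * q)"
proof -
  have "p * Poly_Mapping.single [] c = smul c p"
  proof -
    let ?s = "\<lambda>w. Poly_Mapping.single w (Poly_Mapping.lookup p w)"
    have "sum ?s (Poly_Mapping.keys p) * Poly_Mapping.single [] c = smul c (sum ?s (Poly_Mapping.keys p))"
      by (simp add: sum_distrib_right smul_sum smul_single single_mult_words mult.commute)
    then show ?thesis by (simp add: poly_mapping_sum_single)
  qed
  then show ?thesis by (simp add: smul_eq_mult flip: mult.assoc)
qed

lemma superalgebra_Ser: "superalgebra (Ser k)"
proof (intro superalgebra.intro superalgebra_axioms.intro)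
  interpret ring "Ser k" by (rule ring_Ser)
  interpret M: module complex_field "Ser k" by (rule module_Ser)
  show "module complex_field (Ser k)" by (rule module_Ser)
  show "submodule (hgs (Ser k) i) complex_field (Ser k)" for i
  proof (rule M.submoduleI)
    show "\<ominus>\<^bsub>Ser k\<^esub> x \<in> hgs (Ser k) i" if x: "x \<in> hgs (Ser k) i" for x
    proof -
      obtain p where p: "p \<in> hgs (free_superalg k) i" "x = cls k p"
        using x by (auto simp: Ser_simps)
      then have "\<ominus>\<^bsub>Ser k\<^esub> x = cls k (- p)"
        using hgs_free_closed(1)[of k i]
        by (intro minus_equality) (auto simp: Ser_simps Ser_ops subset_iff)
      then show ?thesis using p hgs_free_closed(3) by (auto simp: Ser_simps)
    qed
  next
    show "hgs (Ser k) i \<subseteq> carrier (Ser k)"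
      using hgs_free_closed(1) by (auto simp: Ser_simps)
  next
    show "x \<oplus>\<^bsub>Ser k\<^esub> y \<in> hgs (Ser k) i" if "x \<in> hgs (Ser k) i" "y \<in> hgs (Ser k) i" for x y
      using that hgs_free_closed(1,5) by (fastforce simp: Ser_simps Ser_ops subset_iff)
  next
    show "c \<odot>\<^bsub>Ser k\<^esub> x \<in> hgs (Ser k) i" if "x \<in> hgs (Ser k) i" for c x
      using that hgs_free_closed(1,4) by (fastforce simp: Ser_simps Ser_ops subset_iff)
  qed (use hgs_free_closed(2) in \<open>auto simp: Ser_simps\<close>)
  show "hgs (Ser k) 0 <+>\<^bsub>Ser k\<^esub> hgs (Ser k) 1 = carrier (Ser k)"
  proof
    show "hgs (Ser k) 0 <+>\<^bsub>Ser k\<^esub> hgs (Ser k) 1 \<subseteq> carrier (Ser k)"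
      using hgs_free_closed(1) by (fastforce simp: set_add_def' Ser_simps Ser_ops subset_iff)
    show "carrier (Ser k) \<subseteq> hgs (Ser k) 0 <+>\<^bsub>Ser k\<^esub> hgs (Ser k) 1"
    proof
      fix x assume "x \<in> carrier (Ser k)"
      then obtain p where p: "p \<in> carrier (free_superalg k)" "x = cls k p" by (auto simp: Ser_simps)
      obtain q r where qr: "p = q + r" "q \<in> hgs (free_superalg k) 0" "r \<in> hgs (free_superalg k) 1"
        by (rule hgs_free_split[OF p(1)])
      then have "x = cls k q \<oplus>\<^bsub>Ser k\<^esub> cls k r"
        unfolding p(2) qr(1) using hgs_free_closed(1) by (subst Ser_ops(2)) blast+
      then show "x \<in> hgs (Ser k) 0 <+>\<^bsub>Ser k\<^esub> hgs (Ser k) 1"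
        using qr by (auto simp: set_add_def' Ser_simps)
    qed
  qed
  show "hgs (Ser k) 0 \<inter> hgs (Ser k) 1 = {\<zero>\<^bsub>Ser k\<^esub>}"
  proof -
    \<comment> \<open>An injective map preserves intersections, so the trivial intersection of the
      two parts is inherited from diagrams.\<close>
    have "phi k ` hgs (Dvec k) 0 \<inter> phi k ` hgs (Dvec k) 1 = phi k ` (hgs (Dvec k) 0 \<inter> hgs (Dvec k) 1)"
      using hgs_Dvec_closed(1) by (intro inj_on_image_Int[symmetric, OF inj_on_phi]) auto
    then show ?thesis
      by (simp add: hgs_Ser_eq hgs_Dvec_disjoint phi_eq_cls Ser_simps)
  qed
  show "x \<otimes>\<^bsub>Ser k\<^esub> y \<in> hgs (Ser k) (i + j)" if "x \<in> hgs (Ser k) i" "y \<in> hgs (Ser k) j" for x y i j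
  proof -
    obtain p q where pq: "p \<in> hgs (free_superalg k) i" "q \<in> hgs (free_superalg k) j" "x = cls k p" "y = cls k q"
      using \<open>x \<in> hgs (Ser k) i\<close> \<open>y \<in> hgs (Ser k) j\<close> by (auto simp: Ser_simps)
    then have "p \<in> carrier (free_superalg k)" "q \<in> carrier (free_superalg k)"
      using hgs_free_closed(1) by blast+
    then show ?thesis using pq hgs_free_closed(6) by (auto simp: Ser_simps Ser_ops)
  qed
  show "(c \<odot>\<^bsub>Ser k\<^esub> x) \<otimes>\<^bsub>Ser k\<^esub> y = c \<odot>\<^bsub>Ser k\<^esub> (x \<otimes>\<^bsub>Ser k\<^esub> y)"
    "x \<otimes>\<^bsub>Ser k\<^esub> (c \<odot>\<^bsub>Ser k\<^esub> y) = c \<odot>\<^bsub>Ser k\<^esub> (x \<otimes>\<^bsub>Ser k\<^esub> y)"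
    if xy: "x \<in> carrier (Ser k)" "y \<in> carrier (Ser k)" for c x y
  proof -
    obtain p q where "p \<in> carrier (free_superalg k)" "x = cls k p"
      "q \<in> carrier (free_superalg k)" "y = cls k q"
      using xy by (auto simp: Ser_simps)
    moreover have "smul c p * q = smul c (p * q)" by (simp add: smul_eq_mult mult.assoc)
    ultimately show "(c \<odot>\<^bsub>Ser k\<^esub> x) \<otimes>\<^bsub>Ser k\<^esub> y = c \<odot>\<^bsub>Ser k\<^esub> (x \<otimes>\<^bsub>Ser k\<^esub> y)"
      "x \<otimes>\<^bsub>Ser k\<^esub> (c \<odot>\<^bsub>Ser k\<^esub> y) = c \<odot>\<^bsub>Ser k\<^esub> (x \<otimes>\<^bsub>Ser k\<^esub> y)"
      by (simp_all add: Ser_ops mult_smul)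
  qed
  show "(x \<oplus>\<^bsub>Ser k\<^esub> y) \<otimes>\<^bsub>Ser k\<^esub> z = x \<otimes>\<^bsub>Ser k\<^esub> z \<oplus>\<^bsub>Ser k\<^esub> y \<otimes>\<^bsub>Ser k\<^esub> z"
    "z \<otimes>\<^bsub>Ser k\<^esub> (x \<oplus>\<^bsub>Ser k\<^esub> y) = z \<otimes>\<^bsub>Ser k\<^esub> x \<oplus>\<^bsub>Ser k\<^esub> z \<otimes>\<^bsub>Ser k\<^esub> y"
    if "x \<in> carrier (Ser k)" "y \<in> carrier (Ser k)" "z \<in> carrier (Ser k)" for x y z
    using that by (rule ringE(3)[OF ring_Ser] ringE(4)[OF ring_Ser])+
  show "x \<otimes>\<^bsub>Ser k\<^esub> y \<in> carrier (Ser k)" if "x \<in> carrier (Ser k)" "y \<in> carrier (Ser k)" for x y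
    using that by (rule m_closed)
qed

lemma assoc_superalgebra_Ser: "assoc_superalgebra (Ser k)"
  by (intro assoc_superalgebra.intro superalgebra_Ser ring.is_monoid ring_Ser)

lemma abelian_group_Dvec: "abelian_group (Dvec k)"
proof (rule abelian_groupI)
  show "\<exists>y\<in>carrier (Dvec k). y \<oplus>\<^bsub>Dvec k\<^esub> x = \<zero>\<^bsub>Dvec k\<^esub>" if "x \<in> carrier (Dvec k)" for x
    using that by (intro bexI[of _ "- x"]) auto
qed (auto simp: algebra_simps)

lemma module_Dvec: "module complex_field (Dvec k)"
  by (intro moduleI cring_from_type_algebra abelian_group_Dvec)
    (auto simp: ring_of_type_algebra_def lookup_add algebra_simps intro!: poly_mapping_eqI)

lemma assoc_superalgebra_Dvec: "assoc_superalgebra (Dvec k)"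
proof (intro assoc_superalgebra.intro superalgebra.intro superalgebra_axioms.intro monoidI)
  interpret S: assoc_superalgebra "Ser k" by (rule assoc_superalgebra_Ser)
  interpret R: ring "Ser k" by (rule ring_Ser)
  interpret M: module complex_field "Dvec k" by (rule module_Dvec)
  note closed = mult_Dvec_closed phi_carrier id_diag_in_superdiagrams
  \<comment> \<open>The attribute \<open>simplified\<close> brings the unit into the form that
    \<open>Dvec_simps\<close> produces.\<close>
  note phi_simps = phi_mult phi_linear phi_one[simplified]
  note inj = inj_onD[OF inj_on_phi[of k]]
  \<comment> \<open>Bilinearity is pulled back along \<open>phi\<close> as well; this avoids the
    defining double sum, whose index sets change when arguments are added or scaled.\<close>
  show "(x \<oplus>\<^bsub>Dvec k\<^esub> y) \<otimes>\<^bsub>Dvec k\<^esub> z = x \<otimes>\<^bsub>Dvec k\<^esub> z \<oplus>\<^bsub>Dvec k\<^esub> y \<otimes>\<^bsub>Dvec k\<^esub> z"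
    "z \<otimes>\<^bsub>Dvec k\<^esub> (x \<oplus>\<^bsub>Dvec k\<^esub> y) = z \<otimes>\<^bsub>Dvec k\<^esub> x \<oplus>\<^bsub>Dvec k\<^esub> z \<otimes>\<^bsub>Dvec k\<^esub> y"
    "x \<otimes>\<^bsub>Dvec k\<^esub> y \<otimes>\<^bsub>Dvec k\<^esub> z = x \<otimes>\<^bsub>Dvec k\<^esub> (y \<otimes>\<^bsub>Dvec k\<^esub> z)"
    if "x \<in> carrier (Dvec k)" "y \<in> carrier (Dvec k)" "z \<in> carrier (Dvec k)" for x y z
    by (rule inj; simp add: that closed phi_simps R.l_distr R.r_distr S.m_assoc)+
  show "(c \<odot>\<^bsub>Dvec k\<^esub> x) \<otimes>\<^bsub>Dvec k\<^esub> y = c \<odot>\<^bsub>Dvec k\<^esub> (x \<otimes>\<^bsub>Dvec k\<^esub> y)"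
    "x \<otimes>\<^bsub>Dvec k\<^esub> (c \<odot>\<^bsub>Dvec k\<^esub> y) = c \<odot>\<^bsub>Dvec k\<^esub> (x \<otimes>\<^bsub>Dvec k\<^esub> y)"
    if "x \<in> carrier (Dvec k)" "y \<in> carrier (Dvec k)" for c x y
    by (rule inj; simp add: that closed phi_simps S.mult_smult_left S.mult_smult_right)+
  show "\<one>\<^bsub>Dvec k\<^esub> \<otimes>\<^bsub>Dvec k\<^esub> x = x" "x \<otimes>\<^bsub>Dvec k\<^esub> \<one>\<^bsub>Dvec k\<^esub> = x" if "x \<in> carrier (Dvec k)" for x
    by (rule inj; simp add: that closed phi_simps)+
  show "submodule (hgs (Dvec k) i) complex_field (Dvec k)" for i
  proof (rule M.submoduleI)
    show "\<ominus>\<^bsub>Dvec k\<^esub> x \<in> hgs (Dvec k) i" if "x \<in> hgs (Dvec k) i" for x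
    proof -
      have "\<ominus>\<^bsub>Dvec k\<^esub> x = - x"
        using that hgs_Dvec_closed(1)[of k i] by (intro M.minus_equality) auto
      then show ?thesis using that hgs_Dvec_closed(3) by simp
    qed
  qed (use hgs_Dvec_closed in \<open>auto simp: subset_iff\<close>)
  show "hgs (Dvec k) 0 <+>\<^bsub>Dvec k\<^esub> hgs (Dvec k) 1 = carrier (Dvec k)"
  proof
    show "hgs (Dvec k) 0 <+>\<^bsub>Dvec k\<^esub> hgs (Dvec k) 1 \<subseteq> carrier (Dvec k)"
      using hgs_Dvec_closed(1) by (fastforce simp: set_add_def')
    show "carrier (Dvec k) \<subseteq> hgs (Dvec k) 0 <+>\<^bsub>Dvec k\<^esub> hgs (Dvec k) 1"
    proof
      fix p assume "p \<in> carrier (Dvec k)"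
      then obtain q r where "p = q + r" "q \<in> hgs (Dvec k) 0" "r \<in> hgs (Dvec k) 1"
        by (rule hgs_Dvec_split)
      then show "p \<in> hgs (Dvec k) 0 <+>\<^bsub>Dvec k\<^esub> hgs (Dvec k) 1"
        by (auto simp: set_add_def')
    qed
  qed
  show "x \<otimes>\<^bsub>Dvec k\<^esub> y \<in> hgs (Dvec k) (i + j)" if "x \<in> hgs (Dvec k) i" "y \<in> hgs (Dvec k) j" for x y i j
    using that by (rule hgs_Dvec_mult)
qed (simp_all add: hgs_Dvec_disjoint module_Dvec id_diag_in_superdiagrams mult_Dvec_closed)

theorem theorem2p2:
  fixes k :: nat
  assumes "k \<ge> 1"
  shows "(\<forall>x\<in>carrier (Dvec k). \<forall>y\<in>carrier (Dvec k).
            phi k (x \<otimes>\<^bsub>Dvec k\<^esub> y) = phi k x \<otimes>\<^bsub>Ser k\<^esub> phi k y)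
         \<and> phi k \<in> superalg_iso (Dvec k) (Ser k)
         \<and> assoc_superalg_isomorphic (Dvec k) (Ser k)"
proof -
  have "phi k \<in> ring_hom (Dvec k) (Ser k)"
    \<comment> \<open>The unit has to stay folded for \<open>phi_one\<close> to apply.\<close>
    by (rule ring_hom_memI) (simp_all add: phi_carrier phi_mult phi_linear phi_one del: Dvec_simps(1))
  then have "phi k \<in> superalg_iso (Dvec k) (Ser k)"
    using phi_hgs inj_on_phi surj_phi by (simp add: superalg_iso_def bij_betw_def phi_linear)
  then show ?thesis
    using assoc_superalgebra_Dvec assoc_superalgebra_Ser
    by (auto simp only: assoc_superalg_isomorphic_def phi_mult)
qed

end
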